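(* Let $\overline{X_{5,2}}$ denote the Zariski closure in $\mathbb{A}^3$ of the set $X_{5,2}$ defined in the context. Then $\overline{X_{5,2}}$ is birational over $\mathbb{Q}$ to the elliptic surface $$E:\; y^2 = 4x^3 + (4t^4 + 4t^3 + 1) x^2 - 2t^3(t+1)^2 (2t^2 + 2t + 1) x + t^6 (t+1)^4 .$$ Moreover, $E$, viewed as an elliptic curve over the function field $\mathbb{Q}(t)$, has positive rank over $\mathbb{Q}(t)$: the point $P=(x,y)=(0,\,t^3(t+1)^2)\in E(\mathbb{Q}(t))$ has infinite order.
   Context: For a triple $(x_3,x_4,x_5)$ (coordinates in $\overline{\mathbb{Q}}$) define the rational function $$\phi(z)=\frac{(a_1 z + a_0)(z-1)}{a_1 z^2 + b_1 z + b_0},$$ where $a_1 = x_4 (x_3^2 x_4 - x_3^2 x_5 - x_3^2 + 2 x_3 x_5 - x_4 x_5)$, $a_0 = x_3^2 x_4(x_4 - 1)(x_5 -x_4 + x_4 x_5 - x_3 x_5)$, $b_0 = -a_0/x_3 = -x_3 x_4(x_4 - 1)(x_5 -x_4 + x_4 x_5 - x_3 x_5)$, $b_1 = x_3^2 x_4^2 x_5 - x_3^3 x_4^2 + 2x_3^3 x_4 - x_3^2 x_4^2 + x_4^3 x_5 - x_3^2 x_4 x_5 - x_3 x_4^2 x_5 - x_3^3 + x_3 x_4^2 - x_4^3 + x_3^2 x_5 + x_3^2 - x_3 x_4 + x_4^2 - x_3 x_5$. Let $\mathcal{PM}_2'$ be the set of triples $(x_3,x_4,x_5)\in\mathbb{A}^3$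 such that $\phi$ has degree exactly $2$ (i.e. numerator and denominator have nonzero resultant) and the points $\infty,1,0,x_3,x_4,x_5$ of $\mathbb{P}^1$ are pairwise distinct; for such triples $\phi$ acts as $\infty\mapsto 1\mapsto 0\mapsto x_3\mapsto x_4\mapsto x_5$. (Every pair $(x,\psi)$, $\psi$ of degree 2 whose first six iterates of $x$ are distinct, is conjugate by a unique Möbius transformation to such a pair $(\infty,\phi)$.) For integers $m\ge 0$, $n\ge1$ with $m+n\ge 6$, $X_{m,n}$ is the set of triples in $\mathcal{PM}_2'$ for which $\phi^{m+n}(\infty)=\phi^m(\infty)$ but $\phi^i(\infty)\ne\phi^j(\infty)$ for all other pairs $i\neq j$ with $0\le i,j\le m+n$. Thus $X_{5,2}$ parametrizes (up to coordinate change) pairs $(x,\phi)$ with $\deg\phi=2$ such that $\phi^5(x)$ is periodic of minimal period $2$ and $x,\phi(x),\dots,\phi^4(x)$ are not periodic. *)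

theory Defs
  imports
    "HOL-Algebra.Algebraic_Closure_Type"
    "HOL-Algebra.FiniteProduct"
    "HOL-Library.Extended_Nat"
    "HOL-Computational_Algebra.Fraction_Field"
    "Subresultants.Resultant_Prelim"
begin

section \<open>Algebraic sets in affine 3-space and birational equivalence over the rationals\<close>

type_synonym qbar = "rat alg_closure"
type_synonym A3 = "qbar \<times> qbar \<times> qbar"
type_synonym poly3 = "qbar poly poly poly"

text \<open>An element of \<open>poly3\<close> is a polynomial in three variables; the innermost variable is
  the first coordinate.\<close>

fun eval3 :: "poly3 \<Rightarrow> A3 \<Rightarrow> qbar" where
  "eval3 f (x, y, z) = poly (poly (poly f [:[:z:]:]) [:y:]) x"

definition Q_poly3 :: "poly3 set" where
  "Q_poly3 = {f. \<forall>i j k.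
     Polynomial.coeff (Polynomial.coeff (Polynomial.coeff f i) j) k \<in> \<rat>}"

definition zariski_closure :: "A3 set \<Rightarrow> A3 set" where
  "zariski_closure S = {p. \<forall>f. (\<forall>q\<in>S. eval3 f q = 0) \<longrightarrow> eval3 f p = 0}"

definition dense_in :: "A3 set \<Rightarrow> A3 set \<Rightarrow> bool" where
  "dense_in U V \<longleftrightarrow> U \<subseteq> V \<and> V \<subseteq> zariski_closure U"

definition open_in_over_Q :: "A3 set \<Rightarrow> A3 set \<Rightarrow> bool" where
  "open_in_over_Q U V \<longleftrightarrow> (\<exists>H \<subseteq> Q_poly3. U = {p \<in> V. \<exists>h\<in>H. eval3 h p \<noteq> 0})"

definition regular_fun_over_Q :: "A3 set \<Rightarrow> (A3 \<Rightarrow> qbar) \<Rightarrow> bool" where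
  "regular_fun_over_Q U f \<longleftrightarrow>
     (\<forall>p\<in>U. \<exists>g\<in>Q_poly3. \<exists>h\<in>Q_poly3. eval3 h p \<noteq> 0 \<and>
        (\<forall>q\<in>U. eval3 h q \<noteq> 0 \<longrightarrow> f q = eval3 g q / eval3 h q))"

text \<open>A rational map from \<open>V\<close> to \<open>W\<close> is represented by a dense open subset \<open>U\<close> of \<open>V\<close>
  together with a morphism \<open>F\<close> from \<open>U\<close> to \<open>W\<close>.\<close>

definition rational_map_over_Q :: "A3 set \<Rightarrow> A3 set \<Rightarrow> A3 set \<Rightarrow> (A3 \<Rightarrow> A3) \<Rightarrow> bool" where
  "rational_map_over_Q V W U F \<longleftrightarrow>
     open_in_over_Q U V \<and> dense_in U V \<and> F ` U \<subseteq> W \<and>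
     regular_fun_over_Q U (\<lambda>p. fst (F p)) \<and>
     regular_fun_over_Q U (\<lambda>p. fst (snd (F p))) \<and>
     regular_fun_over_Q U (\<lambda>p. snd (snd (F p)))"

text \<open>The composite of \<open>(U, F)\<close> with \<open>(U', G)\<close> is a rational map exactly if the (automatically
  open) set where it is defined is dense. Irreducibility of \<open>V\<close> and \<open>W\<close> is
  therefore not needed to make sense of the composites.\<close>

definition birational_over_Q :: "A3 set \<Rightarrow> A3 set \<Rightarrow> bool" where
  "birational_over_Q V W \<longleftrightarrow>
     (\<exists>U F U' G. rational_map_over_Q V W U F \<and> rational_map_over_Q W V U' G \<and>
        dense_in {p \<in> U. F p \<in> U'} V \<and> (\<forall>p\<in>U. F p \<in> U' \<longrightarrow> G (F p) = p) \<and>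
        dense_in {q \<in> U'. G q \<in> U} W \<and> (\<forall>q\<in>U'. G q \<in> U \<longrightarrow> F (G q) = q))"


section \<open>Quadratic rational maps with a marked point\<close>

datatype 'a proj_line = Fin 'a | Infty

text \<open>The action on the projective line of the quotient \<open>N / D\<close> of two polynomials of degree at
  most 2 without common zero (also at infinity, when they are regarded as binary quadratic
  forms).\<close>

fun quad_map :: "'a::field poly \<Rightarrow> 'a poly \<Rightarrow> 'a proj_line \<Rightarrow> 'a proj_line" where
  "quad_map N D Infty =
     (if Polynomial.coeff D 2 = 0 then Infty
      else Fin (Polynomial.coeff N 2 / Polynomial.coeff D 2))"
| "quad_map N D (Fin z) = (if poly D z = 0 then Infty else Fin (poly N z / poly D z))"

definition phi_a1 :: "'a::comm_ring_1 \<Rightarrow> 'a \<Rightarrow> 'a \<Rightarrow> 'a" where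
  "phi_a1 x3 x4 x5 = x4 * (x3^2 * x4 - x3^2 * x5 - x3^2 + 2 * x3 * x5 - x4 * x5)"

definition phi_a0 :: "'a::comm_ring_1 \<Rightarrow> 'a \<Rightarrow> 'a \<Rightarrow> 'a" where
  "phi_a0 x3 x4 x5 = x3^2 * x4 * (x4 - 1) * (x5 - x4 + x4 * x5 - x3 * x5)"

definition phi_b0 :: "'a::comm_ring_1 \<Rightarrow> 'a \<Rightarrow> 'a \<Rightarrow> 'a" where
  "phi_b0 x3 x4 x5 = - x3 * x4 * (x4 - 1) * (x5 - x4 + x4 * x5 - x3 * x5)"

definition phi_b1 :: "'a::comm_ring_1 \<Rightarrow> 'a \<Rightarrow> 'a \<Rightarrow> 'a" where
  "phi_b1 x3 x4 x5 =
     x3^2 * x4^2 * x5 - x3^3 * x4^2 + 2 * x3^3 * x4 - x3^2 * x4^2 + x4^3 * x5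
     - x3^2 * x4 * x5 - x3 * x4^2 * x5 - x3^3 + x3 * x4^2 - x4^3 + x3^2 * x5
     + x3^2 - x3 * x4 + x4^2 - x3 * x5"

fun phi_num :: "A3 \<Rightarrow> qbar poly" where
  "phi_num (x3, x4, x5) = [:phi_a0 x3 x4 x5, phi_a1 x3 x4 x5:] * [:-1, 1:]"

fun phi_den :: "A3 \<Rightarrow> qbar poly" where
  "phi_den (x3, x4, x5) = [:phi_b0 x3 x4 x5, phi_b1 x3 x4 x5, phi_a1 x3 x4 x5:]"

definition phi :: "A3 \<Rightarrow> qbar proj_line \<Rightarrow> qbar proj_line" where
  "phi p = quad_map (phi_num p) (phi_den p)"

text \<open>The resultant is that of binary quadratic forms: it also vanishes if the coefficients of
  \<open>z\<^sup>2\<close> in numerator and denominator are both zero, in which case the degree drops as well.\<close>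

definition PM2' :: "A3 set" where
  "PM2' = {(x3, x4, x5).
     resultant_sub 2 2 (phi_num (x3, x4, x5)) (phi_den (x3, x4, x5)) \<noteq> 0 \<and>
     distinct [Infty, Fin 1, Fin 0, Fin x3, Fin x4, Fin x5]}"

definition X_set :: "nat \<Rightarrow> nat \<Rightarrow> A3 set" where
  "X_set m n = {p \<in> PM2'.
     (phi p ^^ (m + n)) Infty = (phi p ^^ m) Infty \<and>
     (\<forall>i j. i < j \<and> j \<le> m + n \<and> (i, j) \<noteq> (m, m + n) \<longrightarrow>
        (phi p ^^ i) Infty \<noteq> (phi p ^^ j) Infty)}"


section \<open>Elliptic curves \<open>y\<^sup>2 = 4 x\<^sup>3 + A x\<^sup>2 + B x + C\<close>\<close>

text \<open>The discriminant of the cubic on the right-hand side; the curve is nonsingular (in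
  characteristic not 2) if and only if it does not vanish.\<close>

definition cubic_disc :: "'a::comm_ring_1 \<Rightarrow> 'a \<Rightarrow> 'a \<Rightarrow> 'a" where
  "cubic_disc A B C = A^2 * B^2 - 16 * B^3 - 4 * A^3 * C - 432 * C^2 + 72 * A * B * C"

datatype 'a ec_point = Origin | Affine 'a 'a

definition ec_points :: "'a::field \<Rightarrow> 'a \<Rightarrow> 'a \<Rightarrow> 'a ec_point set" where
  "ec_points A B C =
     insert Origin {Affine x y | x y. y^2 = 4 * x^3 + A * x^2 + B * x + C}"

text \<open>Chord-tangent addition. The line of slope \<open>l\<close> through the two points meets the
  curve in a third point, the sum of the three abscissae being \<open>(l\<^sup>2 - A) / 4\<close>.\<close>

fun ec_add :: "'a::field \<Rightarrow> 'a \<Rightarrow> 'a \<Rightarrow> 'a ec_point \<Rightarrow> 'a ec_point \<Rightarrow> 'a ec_point" where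
  "ec_add A B C Origin q = q"
| "ec_add A B C p Origin = p"
| "ec_add A B C (Affine x1 y1) (Affine x2 y2) =
     (if x1 = x2 \<and> y1 = - y2 then Origin
      else let l = (if x1 = x2 then (12 * x1^2 + 2 * A * x1 + B) / (2 * y1)
                    else (y2 - y1) / (x2 - x1));
               x3 = (l^2 - A) / 4 - x1 - x2
           in Affine x3 (- (y1 + l * (x3 - x1))))"

definition EC :: "'a::field \<Rightarrow> 'a \<Rightarrow> 'a \<Rightarrow> 'a ec_point monoid" where
  "EC A B C = \<lparr>carrier = ec_points A B C, monoid.mult = ec_add A B C, one = Origin\<rparr>"

definition infinite_order :: "('a, 'm) monoid_scheme \<Rightarrow> 'a \<Rightarrow> bool" where
  "infinite_order G g \<longleftrightarrow>
     g \<in> carrier G \<and> (\<forall>n::nat. n > 0 \<longrightarrow> g [^]\<^bsub>G\<^esub> n \<noteq> \<one>\<^bsub>G\<^esub>)"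

text \<open>The rank of an abelian group (written multiplicatively): the supremum of the
  cardinalities of its finite subsets that are linearly independent over the integers.\<close>

definition int_independent :: "('a, 'm) monoid_scheme \<Rightarrow> 'a set \<Rightarrow> bool" where
  "int_independent G S \<longleftrightarrow> finite S \<and> S \<subseteq> carrier G \<and>
     (\<forall>c :: 'a \<Rightarrow> int. (\<Otimes>\<^bsub>G\<^esub>g\<in>S. g [^]\<^bsub>G\<^esub> c g) = \<one>\<^bsub>G\<^esub> \<longrightarrow> (\<forall>g\<in>S. c g = 0))"

definition ab_rank :: "('a, 'm) monoid_scheme \<Rightarrow> enat" where
  "ab_rank G = (SUP S\<in>{S. int_independent G S}. enat (card S))"


section \<open>The surface \<open>E\<close>\<close>

definition E_A :: "'a::comm_ring_1 \<Rightarrow> 'a" where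
  "E_A t = 4 * t^4 + 4 * t^3 + 1"

definition E_B :: "'a::comm_ring_1 \<Rightarrow> 'a" where
  "E_B t = - 2 * t^3 * (t + 1)^2 * (2 * t^2 + 2 * t + 1)"

definition E_C :: "'a::comm_ring_1 \<Rightarrow> 'a" where
  "E_C t = t^6 * (t + 1)^4"

definition E_surface :: "A3 set" where
  "E_surface = {(t, x, y). y^2 = 4 * x^3 + E_A t * x^2 + E_B t * x + E_C t}"

type_synonym Qt = "rat poly fract"

definition t_gen :: Qt where
  "t_gen = Fract [:0, 1:] 1"

definition E_Qt :: "Qt ec_point monoid" where
  "E_Qt = EC (E_A t_gen) (E_B t_gen) (E_C t_gen)"

end

theory Submission
  imports Defs "HOL-Computational_Algebra.Fundamental_Theorem_Algebra"
begin

text \<open>Birationality. The six points \<open>\<infinity>, 1, 0, x\<^sub>3, x\<^sub>4, x\<^sub>5\<close> are moved by a Moebius transformation so that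
  \<open>x\<^sub>4, x\<^sub>5, x\<^sub>3\<close> become \<open>0, \<infinity>, 1\<close>. In the resulting coordinates the condition on the 2-cycle
  is an equation \<open>Sig b c s = 0\<close> that, for fixed \<open>c\<close>, describes a curve of genus one, and explicit
  substitutions identify it with the fibre of \<open>E\<close> over \<open>t = c / (1 - c)\<close>. They restrict to a
  bijection between the set \<open>X\<^sub>5\<^sub>,\<^sub>2\<close> itself and a nonempty principal open subset of \<open>E\<close>. The former is
  open and trivially dense in its closure; the latter is dense because \<open>E\<close> is a double cover of the
  plane with a branch polynomial of odd degree in \<open>x\<close>.

  Infinite order. Over a suitable complex root \<open>t\<^sub>0\<close> of the discriminant the curve degenerates to a nodal
  cubic, on which \<open>P\<close> specializes to a smooth point with multiplicative parameter \<open>u\<close>. By induction the multiples of \<open>P\<close>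
  specialize to the points with parameters \<open>u\<^sup>n\<close>, which are never the origin because
  \<open>\<bar>u\<bar> \<noteq> 1\<close>.\<close>

section \<open>Polynomial and rational functions over the rationals\<close>

lemma eval3_add [simp]: "eval3 (f + g) p = eval3 f p + eval3 g p"
  and eval3_mult [simp]: "eval3 (f * g) p = eval3 f p * eval3 g p"
  and eval3_diff [simp]: "eval3 (f - g) p = eval3 f p - eval3 g p"
  and eval3_0 [simp]: "eval3 0 p = 0"
  and eval3_1 [simp]: "eval3 1 p = 1"
  by (cases p; simp)+

text \<open>Stated for an arbitrary set \<open>S\<close> of admissible coefficients, so that it can
  be applied once to each of the three nested levels of \<open>poly3\<close>.\<close>

lemma coeff_mult_closed:
  fixes f g :: "'a::comm_semiring_0 poly"
  assumes "0 \<in> S" "\<And>x y. x \<in> S \<Longrightarrow> y \<in> S \<Longrightarrow> x + y \<in> S" "\<And>x y. x \<in> S \<Longrightarrow> y \<in> S \<Longrightarrow> x * y \<in> S"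
    and "\<And>i. Polynomial.coeff f i \<in> S" "\<And>i. Polynomial.coeff g i \<in> S"
  shows "Polynomial.coeff (f * g) n \<in> S"
proof -
  have "sum h A \<in> S" if "finite A" "\<And>x. x \<in> A \<Longrightarrow> h x \<in> S" for h :: "nat \<Rightarrow> 'a" and A
    using that by (induction A) (auto intro: assms(1,2))
  then show ?thesis by (simp add: Polynomial.coeff_mult assms(3-5))
qed

lemma Q_poly3_add: "f \<in> Q_poly3 \<Longrightarrow> g \<in> Q_poly3 \<Longrightarrow> f + g \<in> Q_poly3"
  by (auto simp: Q_poly3_def)

lemma Q_poly3_mult:
  assumes "f \<in> Q_poly3" "g \<in> Q_poly3"
  shows "f * g \<in> Q_poly3"
proof -
  let ?S1 = "{h :: qbar poly. \<forall>k. Polynomial.coeff h k \<in> \<rat>}"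
  let ?S2 = "{h :: qbar poly poly. \<forall>j. Polynomial.coeff h j \<in> ?S1}"
  have 1: "x * y \<in> ?S1" if "x \<in> ?S1" "y \<in> ?S1" for x y
    using that coeff_mult_closed[of "\<rat>" x y] by simp
  have 2: "x * y \<in> ?S2" if "x \<in> ?S2" "y \<in> ?S2" for x y
    using that coeff_mult_closed[of ?S1 x y] 1 by simp
  have "Polynomial.coeff (f * g) n \<in> ?S2" for n
    by (rule coeff_mult_closed[where S = ?S2])
      (use 2 assms in \<open>auto simp: Q_poly3_def\<close>)
  then show ?thesis by (auto simp: Q_poly3_def)
qed

lemma Q_poly3_const: "c \<in> \<rat> \<Longrightarrow> [:[:[:c:]:]:] \<in> Q_poly3"
  by (auto simp: Q_poly3_def coeff_pCons split: nat.split)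

lemma Q_poly3_vars:
  "[:[:[:0, 1:]:]:] \<in> Q_poly3" "[:[:0, 1:]:] \<in> Q_poly3" "[:0, 1:] \<in> Q_poly3"
  by (auto simp: Q_poly3_def coeff_pCons split: nat.split)

text \<open>Unlike \<^const>\<open>regular_fun_over_Q\<close>, this asks for one global quotient.\<close>

definition ratfun_Q :: "A3 set \<Rightarrow> (A3 \<Rightarrow> qbar) \<Rightarrow> bool" where
  "ratfun_Q S f \<longleftrightarrow> (\<exists>g\<in>Q_poly3. \<exists>h\<in>Q_poly3. \<forall>q\<in>S. eval3 h q \<noteq> 0 \<and> f q = eval3 g q / eval3 h q)"

lemma ratfun_QI:
  assumes "g \<in> Q_poly3" "h \<in> Q_poly3"
    "\<And>q. q \<in> S \<Longrightarrow> eval3 h q \<noteq> 0" "\<And>q. q \<in> S \<Longrightarrow> f q = eval3 g q / eval3 h q"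
  shows "ratfun_Q S f"
  using assms unfolding ratfun_Q_def by blast

lemma one_Q_poly3: "1 \<in> Q_poly3"
  using Q_poly3_const[of 1] by (simp add: one_pCons)

lemma ratfun_Q_const: "c \<in> \<rat> \<Longrightarrow> ratfun_Q S (\<lambda>_. c)"
  by (rule ratfun_QI[OF Q_poly3_const one_Q_poly3]) (auto simp: split: prod.split)

lemma ratfun_Q_vars:
  "ratfun_Q S (\<lambda>q. fst q)" "ratfun_Q S (\<lambda>q. fst (snd q))" "ratfun_Q S (\<lambda>q. snd (snd q))"
  by (rule ratfun_QI[OF Q_poly3_vars(1) one_Q_poly3] ratfun_QI[OF Q_poly3_vars(2) one_Q_poly3]
      ratfun_QI[OF Q_poly3_vars(3) one_Q_poly3]; auto)+

lemma ratfun_Q_mult: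
  assumes "ratfun_Q S f" "ratfun_Q S f'"
  shows "ratfun_Q S (\<lambda>q. f q * f' q)"
proof -
  from assms obtain g h g' h' where *: "g \<in> Q_poly3" "h \<in> Q_poly3" "g' \<in> Q_poly3" "h' \<in> Q_poly3"
    "\<forall>q\<in>S. eval3 h q \<noteq> 0 \<and> f q = eval3 g q / eval3 h q"
    "\<forall>q\<in>S. eval3 h' q \<noteq> 0 \<and> f' q = eval3 g' q / eval3 h' q"
    unfolding ratfun_Q_def by blast
  show ?thesis
    by (rule ratfun_QI[of "g * g'" "h * h'"]) (use * in \<open>auto intro: Q_poly3_mult\<close>)
qed

lemma ratfun_Q_add:
  assumes "ratfun_Q S f" "ratfun_Q S f'"
  shows "ratfun_Q S (\<lambda>q. f q + f' q)"
proof -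
  from assms obtain g h g' h' where *: "g \<in> Q_poly3" "h \<in> Q_poly3" "g' \<in> Q_poly3" "h' \<in> Q_poly3"
    "\<forall>q\<in>S. eval3 h q \<noteq> 0 \<and> f q = eval3 g q / eval3 h q"
    "\<forall>q\<in>S. eval3 h' q \<noteq> 0 \<and> f' q = eval3 g' q / eval3 h' q"
    unfolding ratfun_Q_def by blast
  show ?thesis
    by (rule ratfun_QI[of "g * h' + g' * h" "h * h'"])
      (use * in \<open>auto intro: Q_poly3_mult Q_poly3_add simp: add_frac_eq\<close>)
qed

lemma ratfun_Q_divide:
  assumes "ratfun_Q S f" "ratfun_Q S f'" "\<And>q. q \<in> S \<Longrightarrow> f' q \<noteq> 0"
  shows "ratfun_Q S (\<lambda>q. f q / f' q)"
proof -
  from assms obtain g h g' h' where *: "g \<in> Q_poly3" "h \<in> Q_poly3" "g' \<in> Q_poly3" "h' \<in> Q_poly3"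
    "\<forall>q\<in>S. eval3 h q \<noteq> 0 \<and> f q = eval3 g q / eval3 h q"
    "\<forall>q\<in>S. eval3 h' q \<noteq> 0 \<and> f' q = eval3 g' q / eval3 h' q"
    unfolding ratfun_Q_def by blast
  show ?thesis
    by (rule ratfun_QI[of "g * h'" "h * g'"])
      (use * assms(3) in \<open>auto intro: Q_poly3_mult\<close>)
qed

lemma ratfun_Q_uminus:
  assumes "ratfun_Q S f"
  shows "ratfun_Q S (\<lambda>q. - f q)"
  using ratfun_Q_mult[OF ratfun_Q_const[of "-1"] assms] by simp

lemma ratfun_Q_diff:
  assumes "ratfun_Q S f" "ratfun_Q S f'"
  shows "ratfun_Q S (\<lambda>q. f q - f' q)"
  using ratfun_Q_add[OF assms(1) ratfun_Q_uminus[OF assms(2)]] by simp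

lemma ratfun_Q_power:
  assumes "ratfun_Q S f"
  shows "ratfun_Q S (\<lambda>q. f q ^ n)"
  by (induction n) (auto intro: ratfun_Q_const ratfun_Q_mult assms)

lemmas ratfun_Q_intros = ratfun_Q_const ratfun_Q_vars ratfun_Q_mult ratfun_Q_add ratfun_Q_divide
  ratfun_Q_uminus ratfun_Q_diff ratfun_Q_power Rats_0 Rats_1 Rats_number_of

lemma ratfun_Q_regular: "ratfun_Q U f \<Longrightarrow> regular_fun_over_Q U f"
  unfolding ratfun_Q_def regular_fun_over_Q_def by blast

definition principal_open_Q :: "A3 set \<Rightarrow> A3 set \<Rightarrow> bool" where
  "principal_open_Q U V \<longleftrightarrow> (\<exists>h\<in>Q_poly3. U = {p \<in> V. eval3 h p \<noteq> 0})"

lemma principal_open_Q_refl: "principal_open_Q V V"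
  unfolding principal_open_Q_def by (rule bexI[of _ 1]) (auto simp: one_Q_poly3)

text \<open>The denominator of \<open>f\<close> has no zero on \<open>U\<close>, so removing the
  zeros of \<open>f\<close> amounts to removing those of its numerator, and both conditions combine
  into one product.\<close>

lemma principal_open_Q_nonzero:
  assumes "principal_open_Q U V" "ratfun_Q U f"
  shows "principal_open_Q {p \<in> U. f p \<noteq> 0} V"
proof -
  from assms obtain k g h where *: "k \<in> Q_poly3" "U = {p \<in> V. eval3 k p \<noteq> 0}"
    "g \<in> Q_poly3" "\<forall>q\<in>U. eval3 h q \<noteq> 0 \<and> f q = eval3 g q / eval3 h q"
    unfolding principal_open_Q_def ratfun_Q_def by blast
  then have "{p \<in> U. f p \<noteq> 0} = {p \<in> V. eval3 (k * g) p \<noteq> 0}" by auto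
  then show ?thesis
    unfolding principal_open_Q_def using Q_poly3_mult[OF *(1,3)] by blast
qed

lemma principal_open_Q_open: "principal_open_Q U V \<Longrightarrow> open_in_over_Q U V"
proof -
  assume "principal_open_Q U V"
  then obtain h where "h \<in> Q_poly3" "U = {p \<in> V. eval3 h p \<noteq> 0}"
    unfolding principal_open_Q_def by blast
  then show ?thesis unfolding open_in_over_Q_def by (intro exI[of _ "{h}"]) simp
qed

section \<open>Density of open subsets of double planes\<close>

text \<open>Each of the infinitely many constant polynomials \<open>[:x:]\<close> is a root of
  \<open>f\<close>.\<close>

lemma poly2_eq_0:
  fixes f :: "'a::{idom,ring_char_0} poly poly"
  assumes "\<And>t x. poly (poly f [:x:]) t = 0"
  shows "f = 0"
proof -
  have "poly f [:x:] = 0" for x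
    using assms poly_all_0_iff_0 by blast
  then have "range (\<lambda>x::'a. [:x:]) \<subseteq> {y. poly f y = 0}" by auto
  moreover have "infinite (range (\<lambda>x::'a. [:x:]))"
    using finite_imageD[of "\<lambda>x::'a. [:x:]" UNIV] infinite_UNIV_char_0[where 'a = 'a]
    by (auto simp: inj_on_def)
  ultimately show ?thesis using poly_roots_finite finite_subset by blast
qed

text \<open>Division by the monic polynomial \<open>y^2 - g\<close>. If \<open>f\<close> has
  remainder \<open>r0 + r1 y\<close>, one more subtraction turns \<open>a + y (r0 + r1 y)\<close>
  into \<open>(a + r1 g) + r0 y\<close>.\<close>

lemma quadratic_reduction:
  fixes f :: "'a::comm_ring_1 poly"
  shows "\<exists>q r0 r1. f = [:- g, 0, 1:] * q + [:r0, r1:]"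
proof (induction f)
  case 0
  then show ?case by (intro exI[of _ 0]) auto
next
  case (pCons a f)
  then obtain q r0 r1 where f: "f = [:- g, 0, 1:] * q + [:r0, r1:]" by blast
  have "pCons a f = [:- g, 0, 1:] * pCons r1 q + [:a + r1 * g, r0:]"
    unfolding f by (simp add: algebra_simps)
  then show ?case by blast
qed

text \<open>For nonzero \<open>h1\<close> the degrees of the two sides would differ in
  parity.\<close>

lemma odd_degree_nonsquare:
  fixes h0 h1 :: "'a::idom poly"
  assumes "odd (Polynomial.degree g)" "h0^2 = h1^2 * g"
  shows "h0 = 0" "h1 = 0"
proof -
  have "g \<noteq> 0" using assms(1) by auto
  show "h1 = 0"
  proof (rule ccontr)
    assume "h1 \<noteq> 0"
    with \<open>g \<noteq> 0\<close> assms(2) have "h0 \<noteq> 0" by auto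
    have "2 * Polynomial.degree h0 = 2 * Polynomial.degree h1 + Polynomial.degree g"
      using arg_cong[OF assms(2), of Polynomial.degree] \<open>h1 \<noteq> 0\<close> \<open>g \<noteq> 0\<close> \<open>h0 \<noteq> 0\<close>
      by (simp add: degree_mult_eq degree_power_eq)
    then show False using assms(1) by presburger
  qed
  then show "h0 = 0" using assms(2) by auto
qed

context
  fixes g :: "qbar poly poly" and W :: "A3 set"
  assumes odd_g: "odd (Polynomial.degree g)"
    and W: "W = {(t, x, y). y^2 = poly (poly g [:x:]) t}"
begin

text \<open>\<open>W\<close> is stable under a change of sign of \<open>y\<close>. Adding and
  subtracting the two resulting equations separates \<open>r0\<close> from \<open>y r1\<close>;
  multiplying the latter by \<open>y\<close> gives \<open>r1 g\<close>, which again involves only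
  \<open>t\<close> and \<open>x\<close>.\<close>

lemma vanishing_reduced:
  assumes "\<And>p. p \<in> W \<Longrightarrow> eval3 [:r0, r1:] p = 0"
  shows "r0 = 0" "r1 = 0"
proof -
  have *: "poly (poly r0 [:x:]) t = 0 \<and> poly (poly (r1 * g) [:x:]) t = 0" for t x
  proof -
    obtain y where y: "y^2 = poly (poly g [:x:]) t"
      using nth_root_exists[of 2 "poly (poly g [:x:]) t"] by auto
    have "eval3 [:r0, r1:] (t, x, y) = 0" "eval3 [:r0, r1:] (t, x, -y) = 0"
      using y by (auto intro!: assms simp: W simp del: eval3.simps)
    then have "poly (poly r0 [:x:]) t + y * poly (poly r1 [:x:]) t = 0"
      "poly (poly r0 [:x:]) t - y * poly (poly r1 [:x:]) t = 0" by simp_all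
    then have "poly (poly r0 [:x:]) t = 0" "y * poly (poly r1 [:x:]) t = 0"
      by (auto simp: add_eq_0_iff)
    then show ?thesis using y by (auto simp flip: y)
  qed
  then show "r0 = 0" using poly2_eq_0 by blast
  have "r1 * g = 0" using * by (intro poly2_eq_0) blast
  then show "r1 = 0" using odd_g by auto
qed

text \<open>If \<open>f h\<close> vanishes on \<open>W\<close>, reduce both factors to \<open>f\<^sub>0 + f\<^sub>1 y\<close> and \<open>h\<^sub>0 + h\<^sub>1 y\<close>; the norm
  \<open>h\<^sub>0\<^sup>2 - h\<^sub>1\<^sup>2 g\<close> is nonzero because \<open>g\<close> has odd degree, so \<open>f\<close> reduces to 0.\<close>

lemma principal_open_dense:
  assumes "p0 \<in> W" "eval3 h p0 \<noteq> 0"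
  shows "dense_in {p \<in> W. eval3 h p \<noteq> 0} W"
proof -
  have "eval3 f p = 0" if f: "\<forall>q\<in>{p \<in> W. eval3 h p \<noteq> 0}. eval3 f q = 0" and p: "p \<in> W" for f p
  proof -
    obtain q f0 f1 where qf: "f = [:- g, 0, 1:] * q + [:f0, f1:]"
      using quadratic_reduction by blast
    obtain q' h0 h1 where qh: "h = [:- g, 0, 1:] * q' + [:h0, h1:]"
      using quadratic_reduction by blast
    have W0: "eval3 [:- g, 0, 1:] q = 0" if "q \<in> W" for q
      using that by (auto simp: W power2_eq_square)
    have prod: "[:f0 * h0 + f1 * h1 * g, f0 * h1 + f1 * h0:]
        = [:f0, f1:] * [:h0, h1:] - [:f1 * h1:] * [:- g, 0, 1:]"
      by (simp add: algebra_simps)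
    have "eval3 [:f0 * h0 + f1 * h1 * g, f0 * h1 + f1 * h0:] q = 0" if q: "q \<in> W" for q
    proof -
      have "eval3 h q = 0 \<or> eval3 f q = 0" using f q by blast
      then have "eval3 [:f0, f1:] q = 0 \<or> eval3 [:h0, h1:] q = 0"
        unfolding qf qh eval3_add eval3_mult W0[OF q] by auto
      then show ?thesis
        unfolding prod eval3_diff eval3_mult W0[OF q] by auto
    qed
    from vanishing_reduced[OF this]
    have 1: "f0 * h0 + f1 * h1 * g = 0" "f0 * h1 + f1 * h0 = 0" by auto
    have n0: "h0^2 \<noteq> h1^2 * g"
    proof
      assume "h0^2 = h1^2 * g"
      then have "h0 = 0" "h1 = 0" using odd_degree_nonsquare[OF odd_g] by auto
      then have "eval3 h p0 = 0" unfolding qh eval3_add eval3_mult W0[OF assms(1)] by simp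
      with assms(2) show False by simp
    qed
    \<comment> \<open>Multiplication by the conjugate \<open>h0 - h1 y\<close> turns the two
      equations in 1 into multiples of the norm.\<close>
    have "f0 * (h0^2 - h1^2 * g) = h0 * (f0 * h0 + f1 * h1 * g) - h1 * g * (f0 * h1 + f1 * h0)"
      "f1 * (h0^2 - h1^2 * g) = h0 * (f0 * h1 + f1 * h0) - h1 * (f0 * h0 + f1 * h1 * g)"
      by (simp_all add: algebra_simps power2_eq_square)
    then have "f0 = 0" "f1 = 0" using n0 unfolding 1 by auto
    then show ?thesis unfolding qf eval3_add eval3_mult W0[OF p] by simp
  qed
  then show ?thesis unfolding dense_in_def zariski_closure_def by blast
qed

end

lemma E_surface_dense:
  assumes "principal_open_Q U E_surface" "p0 \<in> U"
  shows "dense_in U E_surface"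
proof -
  define T :: "qbar poly" where "T = [:0, 1:]"
  have 4: "(4::qbar poly) \<noteq> 0" by simp
  have E: "E_surface = {(t, x, y). y^2 = poly (poly [:E_C T, E_B T, E_A T, 4:] [:x:]) t}"
    unfolding E_surface_def E_A_def E_B_def E_C_def T_def
    by (auto simp: power2_eq_square power3_eq_cube algebra_simps numeral_poly)
  have "odd (Polynomial.degree [:E_C T, E_B T, E_A T, 4:])" using 4 by (simp del: One_nat_def)
  from principal_open_dense[OF this E] show ?thesis
    using assms unfolding principal_open_Q_def by blast
qed

section \<open>The orbit of infinity\<close>

text \<open>Laplace expansion along the first row, with every minor again of the form
  \<open>mat n n\<close>, so that the rewriting can be iterated down to size 0.\<close>

lemma det_mat_Suc:
  "det (mat (Suc n) (Suc n) f) =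
     (\<Sum>j<Suc n. f (0, j) * ((- 1) ^ j * det (mat n n (\<lambda>(i, k). f (Suc i, if k < j then k else Suc k)))))"
proof -
  have "mat_delete (mat (Suc n) (Suc n) f) 0 j = mat n n (\<lambda>(i, k). f (Suc i, if k < j then k else Suc k))" for j
    by (rule eq_matI) (auto simp: mat_delete_def)
  then show ?thesis
    by (subst laplace_expansion_row[of _ "Suc n" 0]) (simp_all add: cofactor_def)
qed

lemma resultant_sub_2_2:
  fixes p q :: "'a::comm_ring_1 poly"
  defines "n0 \<equiv> Polynomial.coeff p 0" and "n1 \<equiv> Polynomial.coeff p 1" and "n2 \<equiv> Polynomial.coeff p 2"
    and "d0 \<equiv> Polynomial.coeff q 0" and "d1 \<equiv> Polynomial.coeff q 1" and "d2 \<equiv> Polynomial.coeff q 2"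
  shows "resultant_sub 2 2 p q = (n2 * d0 - n0 * d2)^2 - (n2 * d1 - n1 * d2) * (n1 * d0 - n0 * d1)"
proof -
  have 4: "(2::nat) + 2 = Suc (Suc (Suc (Suc 0)))" by simp
  show ?thesis
    unfolding resultant_sub_def sylvester_mat_sub_def 4 det_mat_Suc
    by (simp add: numeral_2_eq_2 n0_def n1_def n2_def d0_def d1_def d2_def det_mat_Suc algebra_simps numeral_3_eq_3)
qed

text \<open>Multiplicativity of the resultant in the factors \<open>z - 1\<close> and
  \<open>a1 z + a0\<close> of the numerator: with D the denominator they contribute D(1) and
  \<open>a1^2\<close> D(-a0/a1).\<close>

fun phi_res :: "A3 \<Rightarrow> qbar" where
  "phi_res (x, y, z) = phi_a1 x y z * (phi_a1 x y z + phi_b1 x y z + phi_b0 x y z) *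
     (phi_a0 x y z ^ 2 - phi_b1 x y z * phi_a0 x y z + phi_a1 x y z * phi_b0 x y z)"

lemma resultant_phi: "resultant_sub 2 2 (phi_num p) (phi_den p) = phi_res p"
proof -
  obtain x y z where p: "p = (x, y, z)" by (cases p) auto
  show ?thesis
    unfolding p resultant_sub_2_2
    by (simp add: numeral_2_eq_2) (simp add: algebra_simps power2_eq_square)
qed

fun num5 :: "A3 \<Rightarrow> qbar" where
  "num5 (x, y, z) = (phi_a1 x y z * z + phi_a0 x y z) * (z - 1)"

text \<open>The factor of the equation \<open>\<phi> (\<phi> x\<^sub>5) = x\<^sub>5\<close> that remains after removal of the
  solutions with \<open>\<phi> x\<^sub>5 \<in> {x\<^sub>4, x\<^sub>5}\<close>.\<close>

fun cycle_eq :: "A3 \<Rightarrow> qbar" where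
  "cycle_eq (x, y, z) = x^2 * y^2 * z - 2 * x^2 * y * z + x^2 * z - x * y^3 * z + x * y^3 - x * y^2
     + 2 * x * y * z^2 - x * z^2 - y^2 * z^2 + y^2 * z"

text \<open>Cleared of denominators, these are the prescribed values: x goes to y, y to z, and 0 to
  x.\<close>

lemma phi_defs_at:
  fixes x y z :: qbar
  shows "(phi_a1 x y z * x + phi_a0 x y z) * (x - 1)
      = y * (phi_a1 x y z * x^2 + phi_b1 x y z * x + phi_b0 x y z)"
    and "(phi_a1 x y z * y + phi_a0 x y z) * (y - 1)
      = z * (phi_a1 x y z * y^2 + phi_b1 x y z * y + phi_b0 x y z)"
    and "phi_a0 x y z = - x * phi_b0 x y z"
  unfolding phi_a1_def phi_a0_def phi_b1_def phi_b0_def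
  by (simp_all add: algebra_simps power_numeral_reduce)

text \<open>The two preimages of \<open>x\<^sub>5\<close> under \<open>\<phi>\<close> are \<open>x\<^sub>4\<close> and \<open>num6 / den6\<close>; in \<open>X\<^sub>5\<^sub>,\<^sub>2\<close> the latter is
  \<open>\<phi> x\<^sub>5\<close>.\<close>

fun num6 :: "A3 \<Rightarrow> qbar" where
  "num6 (x, y, z) = x * (y - 1) * (x - z) * (x * z - y * z + y - z)"

fun den6 :: "A3 \<Rightarrow> qbar" where
  "den6 (x, y, z) = phi_a1 x y z * (1 - z)"

text \<open>When \<open>cycle_eq\<close> vanishes, y - z splits off from the numerator of phi at z.
  The same factor splits off from the denominator, which leaves \<open>num6 / den6\<close> as the
  value.\<close>

lemma num5_cycle: "num5 (x, y, z) = (y - z) * num6 (x, y, z) - z * (x - 1) * cycle_eq (x, y, z)"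
  unfolding num6.simps num5.simps cycle_eq.simps phi_a1_def phi_a0_def
  by (simp add: algebra_simps power_numeral_reduce)

lemma phi_res_nonzeroD:
  assumes "phi_res (x, y, z) \<noteq> 0"
  shows "phi_a1 x y z \<noteq> 0"
    and "\<not> (poly (phi_num (x, y, z)) w = 0 \<and> poly (phi_den (x, y, z)) w = 0)"
proof -
  define a1 a0 b1 b0 where "a1 = phi_a1 x y z" and "a0 = phi_a0 x y z"
    and "b1 = phi_b1 x y z" and "b0 = phi_b0 x y z"
  have nz: "a1 \<noteq> 0" "a1 + b1 + b0 \<noteq> 0" "a0^2 - b1 * a0 + a1 * b0 \<noteq> 0"
    using assms by (auto simp: a1_def a0_def b1_def b0_def)
  then show "phi_a1 x y z \<noteq> 0" by (simp add: a1_def)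
  show "\<not> (poly (phi_num (x, y, z)) w = 0 \<and> poly (phi_den (x, y, z)) w = 0)"
  proof
    assume "poly (phi_num (x, y, z)) w = 0 \<and> poly (phi_den (x, y, z)) w = 0"
    then have n: "(a1 * w + a0) * (w - 1) = 0" and d: "a1 * w^2 + b1 * w + b0 = 0"
      by (simp_all add: a1_def a0_def b1_def b0_def algebra_simps power2_eq_square)
    from n consider "w = 1" | "a1 * w + a0 = 0" by auto
    then show False
    proof cases
      case 1
      with d nz(2) show False by simp
    next
      case 2
      with d have "a0^2 - b1 * a0 + a1 * b0 = 0" by Groebner_Basis.algebra
      with nz(3) show False ..
    qed
  qed
qed

text \<open>Numerator and denominator have no common zero, so the equation forces the denominator to
  be nonzero at \<open>w\<close>.\<close>

lemma phi_step:
  assumes "phi_res p \<noteq> 0" "poly (phi_num p) w = v * poly (phi_den p) w"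
  shows "phi p (Fin w) = Fin v"
  using assms phi_res_nonzeroD(2)[of "fst p" "fst (snd p)" "snd (snd p)" w]
  by (auto simp: phi_def)

lemma poly_phi_num: "poly (phi_num (x, y, z)) w = (phi_a1 x y z * w + phi_a0 x y z) * (w - 1)"
  and poly_phi_den: "poly (phi_den (x, y, z)) w = phi_a1 x y z * w^2 + phi_b1 x y z * w + phi_b0 x y z"
  by (simp_all add: algebra_simps power2_eq_square)

lemma phi_orbit:
  assumes "phi_res (x, y, z) \<noteq> 0"
  shows "phi (x, y, z) Infty = Fin 1" "phi (x, y, z) (Fin 1) = Fin 0" "phi (x, y, z) (Fin 0) = Fin x"
    "phi (x, y, z) (Fin x) = Fin y" "phi (x, y, z) (Fin y) = Fin z"
proof -
  show "phi (x, y, z) Infty = Fin 1"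
    using phi_res_nonzeroD(1)[OF assms] by (simp add: phi_def numeral_2_eq_2)
  show "phi (x, y, z) (Fin 1) = Fin 0" "phi (x, y, z) (Fin 0) = Fin x"
    by (rule phi_step[OF assms]; simp only: poly_phi_num poly_phi_den phi_defs_at(3); simp)+
  show "phi (x, y, z) (Fin x) = Fin y" "phi (x, y, z) (Fin y) = Fin z"
    by (rule phi_step[OF assms]; simp only: poly_phi_num poly_phi_den phi_defs_at(1,2))+
qed

text \<open>All open conditions on a point of \<open>X_set 5 2\<close>, each as the nonvanishing of
  a polynomial. The last five say that \<open>num6 / den6\<close> differs from 0, 1, x, y and z;
  \<open>den6\<close> itself is nonzero since \<open>phi_a1\<close> and z - 1 are.\<close>

definition X_nice :: "A3 \<Rightarrow> bool" where
  "X_nice p \<longleftrightarrow> (case p of (x, y, z) \<Rightarrow> phi_res p \<noteq> 0 \<and>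
     x \<noteq> 0 \<and> y \<noteq> 0 \<and> z \<noteq> 0 \<and> x - 1 \<noteq> 0 \<and> y - 1 \<noteq> 0 \<and> z - 1 \<noteq> 0 \<and>
     x - y \<noteq> 0 \<and> x - z \<noteq> 0 \<and> y - z \<noteq> 0 \<and>
     num6 p \<noteq> 0 \<and> num6 p - den6 p \<noteq> 0 \<and> num6 p - x * den6 p \<noteq> 0 \<and>
     num6 p - y * den6 p \<noteq> 0 \<and> num6 p - z * den6 p \<noteq> 0)"

text \<open>Vieta's formula for the sum of the two roots of numerator minus z times denominator: the
  leading coefficient is \<open>den6\<close>, and one root is y.\<close>

lemma num6_alt: "num6 (x, y, z) = - y * den6 (x, y, z) - phi_a0 x y z + phi_a1 x y z + z * phi_b1 x y z"
  unfolding num6.simps den6.simps phi_a1_def phi_a0_def phi_b1_def phi_b0_def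
  by Groebner_Basis.algebra

lemma X_set_iff: "p \<in> X_set 5 2 \<longleftrightarrow> cycle_eq p = 0 \<and> X_nice p"
proof -
  obtain x y z where p: "p = (x, y, z)" by (cases p) auto
  define a1 a0 b1 b0 where "a1 = phi_a1 x y z" and "a0 = phi_a0 x y z"
    and "b1 = phi_b1 x y z" and "b0 = phi_b0 x y z"
  note ab = a1_def[symmetric] a0_def[symmetric] b1_def[symmetric] b0_def[symmetric]
  define f where "f = phi (x, y, z)"
  define N where "N w = (a1 * w + a0) * (w - 1)" for w
  define D where "D w = a1 * w^2 + b1 * w + b0" for w
  define n6 d6 where "n6 = num6 (x, y, z)" and "d6 = den6 (x, y, z)"
  have ND: "poly (phi_num (x, y, z)) w = N w" "poly (phi_den (x, y, z)) w = D w" for w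
    unfolding poly_phi_num poly_phi_den ab by (simp_all add: N_def D_def)
  have PM2: "(x, y, z) \<in> PM2' \<longleftrightarrow> phi_res (x, y, z) \<noteq> 0 \<and> distinct [Infty, Fin 1, Fin 0, Fin x, Fin y, Fin z]"
    by (simp add: PM2'_def resultant_phi del: phi_res.simps phi_num.simps phi_den.simps)
  have Ny: "N y = z * D y" using phi_defs_at(2)[of x y z] unfolding ab by (simp add: N_def D_def)
  have n6: "n6 = - y * d6 - a0 + a1 + z * b1" using num6_alt[of x y z] unfolding n6_def[symmetric] d6_def[symmetric] ab .
  have d6: "d6 = a1 * (1 - z)" by (simp add: d6_def a1_def)
  have roots: "N w - z * D w = (w - y) * (d6 * w - n6)" for w
  proof -
    \<comment> \<open>The two quadratic polynomials in \<open>w\<close> agree up to the constant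
      term, so their difference can be read off at \<open>w = y\<close>.\<close>
    have "N w - z * D w - (w - y) * (d6 * w - n6) = N y - z * D y"
      unfolding N_def D_def n6 d6 by Groebner_Basis.algebra
    then show ?thesis unfolding Ny by simp
  qed
  have N5: "N z = (y - z) * n6 - z * (x - 1) * cycle_eq (x, y, z)"
    using num5_cycle[of x y z] unfolding num5.simps ab by (simp add: N_def n6_def)
  have D5: "N z - z * D z = (y - z) * (n6 - z * d6)"
    unfolding roots by Groebner_Basis.algebra
  have orbit: "(f ^^ n) Infty = [Infty, Fin 1, Fin 0, Fin x, Fin y, Fin z, f (Fin z), f (f (Fin z))] ! n"
    if "phi_res (x, y, z) \<noteq> 0" "n \<le> 7" for n
  proof -
    have "n = 0 \<or> n = 1 \<or> n = 2 \<or> n = 3 \<or> n = 4 \<or> n = 5 \<or> n = 6 \<or> n = 7" using that(2) by arith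
    then show ?thesis
      using phi_orbit[OF that(1)] unfolding f_def[symmetric]
      by (elim disjE) (simp_all add: eval_nat_numeral)
  qed
  show ?thesis
  proof
    assume X: "p \<in> X_set 5 2"
    then have res: "phi_res (x, y, z) \<noteq> 0" and dist: "distinct [Infty, Fin 1, Fin 0, Fin x, Fin y, Fin z]"
      and per: "(f ^^ 7) Infty = (f ^^ 5) Infty"
      and neq: "\<And>i j. i < j \<Longrightarrow> j \<le> 7 \<Longrightarrow> (i, j) \<noteq> (5, 7) \<Longrightarrow> (f ^^ i) Infty \<noteq> (f ^^ j) Infty"
      unfolding X_set_def p f_def using PM2 by auto
    have "f (Fin z) \<noteq> Infty" "f (Fin z) \<noteq> Fin 1" "f (Fin z) \<noteq> Fin 0" "f (Fin z) \<noteq> Fin x"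
      "f (Fin z) \<noteq> Fin y" "f (Fin z) \<noteq> Fin z"
      using neq[of 0 6] neq[of 1 6] neq[of 2 6] neq[of 3 6] neq[of 4 6] neq[of 5 6]
      using phi_orbit(1)[OF res] by (auto simp: orbit[OF res] simp flip: f_def)
    then obtain w where w: "f (Fin z) = Fin w" "w \<noteq> 1" "w \<noteq> 0" "w \<noteq> x" "w \<noteq> y" "w \<noteq> z"
      by (cases "f (Fin z)") auto
    have fw: "f (Fin w) = Fin z" using per w(1) by (simp add: orbit[OF res])
    have Nz: "N z = w * D z" "D z \<noteq> 0"
      using w(1) by (auto simp: f_def phi_def ND split: if_splits simp del: phi_num.simps phi_den.simps)
    have "N w = z * D w"
      using fw by (auto simp: f_def phi_def ND split: if_splits simp del: phi_num.simps phi_den.simps)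
    then have nw: "n6 = d6 * w" using roots[of w] w by auto
    have "a1 \<noteq> 0" using phi_res_nonzeroD(1)[OF res] by (simp add: a1_def)
    then have d60: "d6 \<noteq> 0" using dist by (simp add: d6)
    \<comment> \<open>As w is not z, \<open>D5\<close> yields the value of \<open>D z\<close>;
      inserting it into \<open>N5\<close> cancels everything except the term with
      \<open>cycle_eq\<close>.\<close>
    have "(w - z) * (D z - (y - z) * d6) = 0"
      using D5 unfolding Nz nw by Groebner_Basis.algebra
    then have "D z = (y - z) * d6" using w by auto
    then have "z * (x - 1) * cycle_eq (x, y, z) = 0"
      using N5 unfolding Nz nw by Groebner_Basis.algebra
    then have "cycle_eq (x, y, z) = 0" using dist by auto
    moreover have "X_nice (x, y, z)"
      unfolding X_nice_def prod.case n6_def[symmetric] d6_def[symmetric] nw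
      using res dist w d60 by (auto simp: mult.commute[of d6] simp del: phi_res.simps)
    ultimately show "cycle_eq p = 0 \<and> X_nice p" by (simp add: p)
  next
    assume "cycle_eq p = 0 \<and> X_nice p"
    then have C: "cycle_eq (x, y, z) = 0" and nice: "X_nice (x, y, z)" by (auto simp: p)
    then have res: "phi_res (x, y, z) \<noteq> 0" and d: "distinct [Infty, Fin 1, Fin 0, Fin x, Fin y, Fin z]"
      and w6: "n6 \<noteq> 0" "n6 \<noteq> d6" "n6 \<noteq> x * d6" "n6 \<noteq> y * d6" "n6 \<noteq> z * d6"
      by (auto simp: X_nice_def n6_def d6_def simp del: phi_res.simps num6.simps den6.simps)
    have "a1 \<noteq> 0" using phi_res_nonzeroD(1)[OF res] by (simp add: a1_def)
    then have d60: "d6 \<noteq> 0" using d by (simp add: d6)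
    define w where "w = n6 / d6"
    have nw: "n6 = w * d6" using d60 by (simp add: w_def)
    have w: "w \<noteq> 0" "w \<noteq> 1" "w \<noteq> x" "w \<noteq> y" "w \<noteq> z" using w6 by (auto simp: nw)
    have Nz: "N z = (y - z) * n6" using N5 C by simp
    have "z * (D z - (y - z) * d6) = 0" using D5 unfolding Nz by Groebner_Basis.algebra
    then have Dz: "D z = (y - z) * d6" using d by auto
    have fz: "f (Fin z) = Fin w"
      unfolding f_def by (rule phi_step[OF res]) (simp add: ND Nz Dz nw mult_ac del: phi_num.simps phi_den.simps)
    have fw: "f (Fin w) = Fin z"
      unfolding f_def using roots[of w]
      by (intro phi_step[OF res]) (simp add: ND nw del: phi_num.simps phi_den.simps)
    have orb: "(f ^^ n) Infty = [Infty, Fin 1, Fin 0, Fin x, Fin y, Fin z, Fin w, Fin z] ! n" if "n \<le> 7" for n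
      using orbit[OF res that] by (simp add: fz fw)
    \<comment> \<open>The iterate of index 7 repeats that of index 5, so the orbit is described by
      seven distinct points and a change of index.\<close>
    define L where "L = [Infty, Fin 1, Fin 0, Fin x, Fin y, Fin z, Fin w]"
    have L: "distinct L" using d w by (auto simp: L_def)
    have orbL: "(f ^^ n) Infty = L ! (if n = 7 then 5 else n)" if "n \<le> 7" for n
    proof (cases "n = 7")
      case True
      then show ?thesis unfolding orb[OF that] by (simp add: L_def)
    next
      case False
      then have "n < length L" using that by (simp add: L_def)
      then show ?thesis using False unfolding orb[OF that]
        by (simp add: L_def nth_append[of L "[Fin z]", unfolded L_def append.simps])
    qed
    have ne: "(f ^^ i) Infty \<noteq> (f ^^ j) Infty" if "i < j" "j \<le> 7" "(i, j) \<noteq> (5, 7)" for i j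
    proof
      assume "(f ^^ i) Infty = (f ^^ j) Infty"
      then have "L ! (if i = 7 then 5 else i) = L ! (if j = 7 then 5 else j)"
        using orbL[of i] orbL[of j] that by simp
      moreover have "length L = 7" by (simp add: L_def)
      ultimately have "(if i = 7 then 5 else i) = (if j = 7 then 5 else j)"
        using that by (subst (asm) nth_eq_iff_index_eq[OF L]) auto
      then show False using that by (auto split: if_splits)
    qed
    have "(f ^^ 7) Infty = (f ^^ 5) Infty" by (simp add: orb)
    then have "(f ^^ (5 + 2)) Infty = (f ^^ 5) Infty" by simp
    moreover have "\<forall>i j. i < j \<and> j \<le> 5 + 2 \<and> (i, j) \<noteq> (5, 5 + 2) \<longrightarrow> (f ^^ i) Infty \<noteq> (f ^^ j) Infty"
      using ne by simp
    moreover have "(x, y, z) \<in> PM2'" using PM2 res d by blast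
    ultimately show "p \<in> X_set 5 2" unfolding X_set_def p f_def by blast
  qed
qed

section \<open>The birational map\<close>

text \<open>For fixed \<open>c\<close> the surface is an elliptic curve with equation
  \<open>\<eta>\<^sup>2 - \<eta> M = \<xi>\<^sup>3 - (c + 2) \<xi>\<^sup>2 + \<xi>\<close>. Completing the square and moving \<open>\<xi> = 1\<close> to \<open>x = 0\<close> gives \<open>E\<close>, with
  \<open>c = t / (t + 1)\<close>.\<close>

lemma weierstrass_identity:
  fixes c \<xi> \<eta> :: "'a::field_char_0"
  assumes c: "c \<noteq> 0" "1 - c \<noteq> 0"
  defines "t \<equiv> c / (1 - c)"
  defines "l \<equiv> t * (t + 1)"
  defines "M \<equiv> ((1 - 2 * c - c^2) * \<xi> + c - 1) / c"
  shows "(l^3 * (2 * \<eta> - M))^2 - (4 * (l^2 * (\<xi> - 1))^3 + E_A t * (l^2 * (\<xi> - 1))^2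
      + E_B t * (l^2 * (\<xi> - 1)) + E_C t)
    = 4 * l^6 * (\<eta>^2 - \<eta> * M - \<xi>^3 + (c + 2) * \<xi>^2 - \<xi>)"
proof -
  \<comment> \<open>Expressed in \<open>l\<close> and \<open>c\<close>, the three coefficients carry
    the factors \<open>l^2\<close>, \<open>l^4\<close> and \<open>l^6\<close>, so the weighted
    scaling of x and y pulls out \<open>l^6\<close>.\<close>
  have l: "l = c / (1 - c)^2" using c by (simp add: l_def t_def divide_simps power2_eq_square)
  have A: "E_A t = l^2 * ((4 * c^3 + (1 - c)^4) / c^2)"
    using c by (simp add: E_A_def l t_def divide_simps) (simp add: algebra_simps power_numeral_reduce)
  have B: "E_B t = l^4 * (- 2 * (1 + c^2) * (1 - c) / c)"
    using c by (simp add: E_B_def l t_def divide_simps) (simp add: algebra_simps power_numeral_reduce)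
  have C: "E_C t = l^6 * (1 - c)^2"
    using c by (simp add: E_C_def l t_def divide_simps)
  have M: "M^2 = 4 * (\<xi> - 1)^3 + ((4 * c^3 + (1 - c)^4) / c^2) * (\<xi> - 1)^2
      + (- 2 * (1 + c^2) * (1 - c) / c) * (\<xi> - 1) + (1 - c)^2 - 4 * (\<xi>^3 - (c + 2) * \<xi>^2 + \<xi>)"
    using c(1) by (simp add: M_def divide_simps) (simp add: algebra_simps power_numeral_reduce)
  have "(l^3 * (2 * \<eta> - M))^2 - (4 * (l^2 * u)^3 + l^2 * a * (l^2 * u)^2 + l^4 * b * (l^2 * u) + l^6 * e)
    = l^6 * (4 * \<eta>^2 - 4 * \<eta> * M + M^2 - (4 * u^3 + a * u^2 + b * u + e))" for u a b e
    by (simp add: algebra_simps power_numeral_reduce)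
  then have "(l^3 * (2 * \<eta> - M))^2 - (4 * (l^2 * (\<xi> - 1))^3 + E_A t * (l^2 * (\<xi> - 1))^2
      + E_B t * (l^2 * (\<xi> - 1)) + E_C t)
    = l^6 * (4 * \<eta>^2 - 4 * \<eta> * M + M^2 - (4 * (\<xi> - 1)^3 + ((4 * c^3 + (1 - c)^4) / c^2) * (\<xi> - 1)^2
      + (- 2 * (1 + c^2) * (1 - c) / c) * (\<xi> - 1) + (1 - c)^2))"
    unfolding A B C .
  also have "\<dots> = 4 * l^6 * (\<eta>^2 - \<eta> * M - \<xi>^3 + (c + 2) * \<xi>^2 - \<xi>)"
    unfolding M by (simp add: algebra_simps)
  finally show ?thesis .
qed

text \<open>The equation of \<open>X\<^sub>5\<^sub>,\<^sub>2\<close> in the coordinates \<open>b\<close>, \<open>c\<close>, \<open>s\<close>; on the elliptic curve above,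
  \<open>b = - \<eta> / \<xi>\<close> and \<open>1 - (b - c) s = 1 / \<xi>\<close>.\<close>

definition Sig :: "'a::comm_ring_1 \<Rightarrow> 'a \<Rightarrow> 'a \<Rightarrow> 'a" where
  "Sig b c s = (b - 1) * s * (s - 1) * c^2 - (b^2 * s * (s - 1) + b - 1) * c + b * s * (b * s - 1)"

text \<open>Powers of \<open>\<xi> * r = 1\<close> make all terms homogeneous of degree 3 in \<xi>.
  The remaining polynomial in r vanishes for b = c, where r = 1, and its cofactor is
  \<open>- Sig b c s\<close>.\<close>

lemma Sig_identity:
  fixes b c s \<xi> :: "'a::field_char_0"
  assumes c: "c \<noteq> 0" and \<xi>: "\<xi> * (1 - (b - c) * s) = 1"
  shows "c * ((- b * \<xi>)^2 - (- b * \<xi>) * (((1 - 2 * c - c^2) * \<xi> + c - 1) / c) - \<xi>^3 + (c + 2) * \<xi>^2 - \<xi>)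
    = - (\<xi>^3 * (b - c) * Sig b c s)"
proof -
  define r where "r = 1 - (b - c) * s"
  have r: "\<xi> * r = 1" using \<xi> by (simp add: r_def)
  have "c * ((- b * \<xi>)^2 - (- b * \<xi>) * (((1 - 2 * c - c^2) * \<xi> + c - 1) / c) - \<xi>^3 + (c + 2) * \<xi>^2 - \<xi>)
    = c * b^2 * \<xi>^2 + b * \<xi> * ((1 - 2 * c - c^2) * \<xi> + c - 1) - c * \<xi>^3 + c * (c + 2) * \<xi>^2 - c * \<xi>"
    using c by (simp add: field_simps power2_eq_square)
  also have "\<dots> = c * b^2 * (\<xi>^2 * (\<xi> * r)) + b * (\<xi> * (\<xi> * r)) * ((1 - 2 * c - c^2) * \<xi> + (c - 1) * (\<xi> * r))
       - c * \<xi>^3 + c * (c + 2) * \<xi>^2 * (\<xi> * r) - c * \<xi> * (\<xi> * r)^2"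
    unfolding r by simp
  also have "\<dots> = \<xi>^3 * ((c * b^2 + (1 - 2 * c - c^2) * b + c * (c + 2)) * r + ((c - 1) * b - c) * r^2 - c)"
    by (simp add: algebra_simps power_numeral_reduce)
  also have "(c * b^2 + (1 - 2 * c - c^2) * b + c * (c + 2)) * r + ((c - 1) * b - c) * r^2 - c = - ((b - c) * Sig b c s)"
    unfolding r_def Sig_def by (simp add: algebra_simps power_numeral_reduce)
  finally show ?thesis by simp
qed

lemma Sig_cycle_eq:
  fixes x y z :: qbar
  assumes "y \<noteq> 0" "z \<noteq> 0" "1 - z \<noteq> 0" "x - y \<noteq> 0"
  defines "b \<equiv> y * (x - z) / (z * (x - y))" and "c \<equiv> (1 - y) * (x - z) / ((1 - z) * (x - y))"
    and "s \<equiv> z / y"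
  shows "Sig b c s * (z * (1 - z)^2 * (x - y)^3 * y^2) = (z - x) * (y - z)^2 * cycle_eq (x, y, z)"
proof -
  \<comment> \<open>\<open>d\<close> is the image of infinity under the Moebius transformation that
    sends y, z, x to 0, infinity, 1. In terms of \<open>d\<close> and \<open>k\<close> the
    coordinates satisfy relations free of division.\<close>
  define d where "d = (x - z) / (x - y)"
  define k where "k = (1 - y) / (1 - z)"
  have d: "d * (x - y) = x - z" and k: "k * (1 - z) = 1 - y"
    using assms by (simp_all add: d_def k_def)
  have b: "z * b = y * d" and c: "c = d * k" and s: "y * s = z"
    using assms(1-4) by (simp_all add: b_def c_def d_def k_def s_def mult.commute)
  have "y^2 * z * Sig b c s = (z * b - z) * (y * s) * (y * s - y) * c^2
      - ((z * b) * (y * b * s) * (y * s - y) + y^2 * (z * b - z)) * c + y^2 * z * (b * s) * (b * s - 1)"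
    unfolding Sig_def by (simp add: algebra_simps power_numeral_reduce)
  also have "y * b * s = y * d" using b s assms(1,2) by (metis mult.commute mult.assoc)
  also have "b * s = d" using b s assms(1,2) unfolding s_def by (simp add: field_simps)
  finally have S: "y^2 * z * Sig b c s = (y * d - z) * z * (z - y) * (d * k)^2
      - ((y * d) * (y * d) * (z - y) + y^2 * (y * d - z)) * (d * k) + y^2 * z * d * (d - 1)"
    unfolding b s c .
  have "y^2 * z * Sig b c s * ((1 - z)^2 * (x - y)^3)
     = (y * (d * (x - y)) - z * (x - y)) * z * (z - y) * (d * (x - y))^2 * (k * (1 - z))^2
      - ((y * (d * (x - y)))^2 * (z - y) + y^2 * (y * (d * (x - y)) - z * (x - y)) * (x - y)) * (d * (x - y)) * (k * (1 - z)) * (1 - z)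
      + y^2 * z * (d * (x - y)) * (d * (x - y) - (x - y)) * (x - y) * (1 - z)^2"
    unfolding S by Groebner_Basis.algebra
  also have "\<dots> = (z - x) * (y - z)^2 * cycle_eq (x, y, z)"
    unfolding d k cycle_eq.simps by Groebner_Basis.algebra
  finally show ?thesis by (simp add: mult_ac)
qed

text \<open>With \<open>n\<close> the Moebius transformation that sends \<open>x\<^sub>4, x\<^sub>5, x\<^sub>3\<close> to \<open>0, \<infinity>, 1\<close>, the new coordinates are
  \<open>b = n 0\<close>, \<open>c = n 1\<close> and \<open>s = n \<infinity> / b\<close>.\<close>

definition to_bcs :: "A3 \<Rightarrow> A3" where
  "to_bcs = (\<lambda>(x, y, z). (y * (x - z) / (z * (x - y)), (1 - y) * (x - z) / ((1 - z) * (x - y)), z / y))"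

text \<open>The images of 1, 0 and infinity under the Moebius transformation that sends b, c and b s
  to 0, 1 and infinity.\<close>

definition of_bcs :: "A3 \<Rightarrow> A3" where
  "of_bcs = (\<lambda>(b, c, s). ((b - 1) * (b * s - c) / ((b - c) * (b * s - 1)),
     (b * s - c) / (s * (b - c)), (b * s - c) / (b - c)))"

definition to_E :: "A3 \<Rightarrow> A3" where
  "to_E = (\<lambda>(b, c, s). let t = c / (1 - c); l = t * (t + 1); \<xi> = 1 / (1 - (b - c) * s) in
     (t, l^2 * (\<xi> - 1), l^3 * (2 * (- b * \<xi>) - ((1 - 2 * c - c^2) * \<xi> + c - 1) / c)))"

text \<open>\<open>E_xi\<close> and \<open>E_eta\<close> solve the substitution
  \<open>x = l^2 (\<xi> - 1)\<close>, \<open>y = l^3 (2 \<eta> - M)\<close> of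
  \<open>weierstrass_identity\<close> for \<xi> and \<eta>.\<close>

definition E_xi :: "A3 \<Rightarrow> qbar" where
  "E_xi = (\<lambda>(t, x, y). 1 + x / (t * (t + 1))^2)"

definition E_eta :: "A3 \<Rightarrow> qbar" where
  "E_eta = (\<lambda>(t, x, y). let c = t / (t + 1) in
     (y / (t * (t + 1))^3 + ((1 - 2 * c - c^2) * E_xi (t, x, y) + c - 1) / c) / 2)"

definition of_E :: "A3 \<Rightarrow> A3" where
  "of_E = (\<lambda>(t, x, y). let c = t / (t + 1); \<xi> = E_xi (t, x, y); \<eta> = E_eta (t, x, y); b = - \<eta> / \<xi> in
     (b, c, (\<xi> - 1) / (\<xi> * (b - c))))"

section \<open>The coordinate changes and their inverses\<close>

lemma of_bcs_to_bcs:
  assumes "y \<noteq> 0" "z \<noteq> 0" "x - 1 \<noteq> 0" "z - 1 \<noteq> 0" "x - y \<noteq> 0" "x - z \<noteq> 0" "y - z \<noteq> 0"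
    and bcs: "to_bcs (x, y, z) = (b, c, s)"
  shows "of_bcs (b, c, s) = (x, y, z)" "s \<noteq> 0" "b - c \<noteq> 0" "b * s - 1 \<noteq> 0" "1 - c \<noteq> 0"
proof -
  define d where "d = (x - z) / (x - y)"
  have b: "b = y * d / z" and c: "c = (1 - y) * d / (1 - z)" and s: "s = z / y"
    using bcs by (auto simp: to_bcs_def d_def)
  have z1: "1 - z \<noteq> 0" using assms(4) by simp
  have d0: "d \<noteq> 0" using assms by (simp add: d_def)
  have d: "d * (x - y) = x - z" using assms by (simp add: d_def)
  have bs: "b * s = d" using assms(1,2) by (simp add: b s)
  have "b - c = d * (y - z) / (z * (1 - z))"
    using assms(2) z1 by (simp add: b c divide_simps) (simp add: algebra_simps)
  then have bc: "(b - c) * (z * (1 - z)) = d * (y - z)" using assms(2) z1 by simp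
  then show bc0: "b - c \<noteq> 0" using d0 assms by auto
  have d1: "(d - 1) * (x - y) = y - z" using d by (simp add: algebra_simps)
  then show bs1: "b * s - 1 \<noteq> 0" using bs assms by auto
  show "s \<noteq> 0" using assms(1,2) by (simp add: s)
  have "(1 - c) * ((1 - z) * (x - y)) = (x - 1) * (y - z)"
    using z1 d by (simp add: c divide_simps) Groebner_Basis.algebra
  then show "1 - c \<noteq> 0" using assms by auto
  have dc: "(d - c) * (1 - z) = d * (y - z)" using z1 by (simp add: c divide_simps) (simp add: algebra_simps)
  have "(b * s - c) * z1 = z * ((b - c) * z1)" if "z1 = z * (1 - z)" for z1
    using dc bc unfolding bs that by Groebner_Basis.algebra
  then have "(b * s - c) * (z * (1 - z)) = z * (b - c) * (z * (1 - z))" by (simp add: mult.assoc)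
  \<comment> \<open>This recovers z as \<open>(b * s - c) / (b - c)\<close>; the other two
    coordinates follow from it.\<close>
  then have w: "b * s - c = z * (b - c)" using assms(2) z1 by (simp only: mult_cancel_right) simp
  have "(b - 1) * z = x * (b * s - 1)"
  proof -
    have "((b - 1) * z - x * (b * s - 1)) * (x - y) = 0"
      unfolding bs using d assms(2) by (simp add: b divide_simps) Groebner_Basis.algebra
    then show ?thesis using assms(5) by simp
  qed
  then show "of_bcs (b, c, s) = (x, y, z)"
    unfolding of_bcs_def prod.case w using bc0 bs1 assms(1,2) by (simp add: s divide_simps mult.assoc)
qed

lemma to_bcs_of_bcs:
  assumes "s \<noteq> 0" "b - c \<noteq> 0" "b * s - 1 \<noteq> 0"
    and xyz: "of_bcs (b, c, s) = (x, y, z)"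
    and "y \<noteq> 0" "z - 1 \<noteq> 0" "x - y \<noteq> 0"
  shows "to_bcs (x, y, z) = (b, c, s)"
proof -
  define w where "w = (b * s - c) / (b - c)"
  have x: "x = (b - 1) * w / (b * s - 1)" and y: "y = w / s" and z: "z = w"
    using xyz by (auto simp: of_bcs_def w_def)
  have w: "w * (b - c) = b * s - c" using assms(2) by (simp add: w_def)
  have w0: "w \<noteq> 0" using assms(5) y by auto
  have z1: "1 - w \<noteq> 0" using assms(6) z by auto
  have xs: "x * (b * s - 1) = (b - 1) * w" using assms(3) by (simp add: x)
  have ys: "y * s = w" using assms(1) by (simp add: y)
  have xz: "x - z = b * s * (x - y)"
    using xs ys unfolding z by Groebner_Basis.algebra
  have "(1 - y) * (b * s) = c * (1 - w)" using w ys by Groebner_Basis.algebra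
  then have "(1 - y) * (x - z) / ((1 - z) * (x - y)) = c"
    unfolding xz using z1 assms(7) by (simp add: z divide_simps mult_ac)
  moreover have "y * (x - z) / (z * (x - y)) = b"
    unfolding xz using ys w0 assms(7) by (simp add: z divide_simps mult_ac)
  moreover have "z / y = s" using ys assms(5) unfolding z by (simp add: divide_simps mult_ac)
  ultimately show ?thesis by (simp add: to_bcs_def)
qed

text \<open>By \<open>weierstrass_identity\<close> and \<open>Sig_identity\<close> the defect in the
  equation of E is \<open>Sig b c s\<close> times a factor that is nonzero under the hypotheses.
  Both directions of the bijection use this.\<close>

lemma to_E_on_surface:
  assumes c: "c \<noteq> 0" "1 - c \<noteq> 0" and r: "1 - (b - c) * s \<noteq> 0" and bc: "b - c \<noteq> 0"
  shows "to_E (b, c, s) \<in> E_surface \<longleftrightarrow> Sig b c s = 0"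
proof -
  define t where "t = c / (1 - c)"
  define l where "l = t * (t + 1)"
  define \<xi> where "\<xi> = 1 / (1 - (b - c) * s)"
  define M where "M = ((1 - 2 * c - c^2) * \<xi> + c - 1) / c"
  define S where "S = (- b * \<xi>)^2 - (- b * \<xi>) * M - \<xi>^3 + (c + 2) * \<xi>^2 - \<xi>"
  have \<xi>: "\<xi> * (1 - (b - c) * s) = 1" using r by (simp add: \<xi>_def)
  have "t + 1 = 1 / (1 - c)" using c by (simp add: t_def divide_simps)
  then have l0: "l \<noteq> 0" using c by (simp add: l_def t_def)
  have "to_E (b, c, s) = (t, l^2 * (\<xi> - 1), l^3 * (2 * (- b * \<xi>) - M))"
    by (simp add: to_E_def Let_def t_def l_def \<xi>_def M_def)
  then have "to_E (b, c, s) \<in> E_surface \<longleftrightarrow>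
    (l^3 * (2 * (- b * \<xi>) - M))^2 - (4 * (l^2 * (\<xi> - 1))^3 + E_A t * (l^2 * (\<xi> - 1))^2
      + E_B t * (l^2 * (\<xi> - 1)) + E_C t) = 0"
    by (simp only: E_surface_def mem_Collect_eq prod.case right_minus_eq)
  also have "\<dots> \<longleftrightarrow> 4 * l^6 * S = 0"
    using weierstrass_identity[OF c, of "- b * \<xi>" \<xi>]
    unfolding t_def[symmetric] l_def[symmetric] M_def[symmetric] S_def[symmetric] by simp
  also have "\<dots> \<longleftrightarrow> c * S = 0" using l0 c by simp
  also have "c * S = - (\<xi>^3 * (b - c) * Sig b c s)"
    using Sig_identity[OF c(1) \<xi>] unfolding M_def[symmetric] S_def[symmetric] .
  finally show ?thesis using bc \<xi> by auto
qed

text \<open>On the surface \<open>\<xi>\<close> has no pole unless \<open>c = 0\<close>.\<close>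

lemma Sig_at_pole: "1 - (b - c) * s = 0 \<Longrightarrow> (b - c) * Sig b c s = c" for b c s :: "'a::field"
  unfolding Sig_def by Groebner_Basis.algebra

lemma E_coords:
  assumes "to_E (b, c, s) = (t, x, y)" and c: "c \<noteq> 0" "1 - c \<noteq> 0" and r: "1 - (b - c) * s \<noteq> 0"
  shows "t \<noteq> 0" "t + 1 \<noteq> 0" "t / (t + 1) = c" "E_xi (t, x, y) = 1 / (1 - (b - c) * s)"
    "E_eta (t, x, y) = - b * E_xi (t, x, y)"
proof -
  define l where "l = t * (t + 1)"
  have t: "t = c / (1 - c)" using assms(1) by (auto simp: to_E_def Let_def)
  show "t \<noteq> 0" using c by (simp add: t)
  have t1: "t + 1 = 1 / (1 - c)" using c by (simp add: t divide_simps)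
  then show "t + 1 \<noteq> 0" using c by simp
  show tc: "t / (t + 1) = c" unfolding t1 using c by (simp add: t)
  have l0: "l \<noteq> 0" using \<open>t \<noteq> 0\<close> \<open>t + 1 \<noteq> 0\<close> by (simp add: l_def)
  have x: "x = l^2 * (1 / (1 - (b - c) * s) - 1)"
    and y: "y = l^3 * (2 * (- b * (1 / (1 - (b - c) * s))) - ((1 - 2 * c - c^2) * (1 / (1 - (b - c) * s)) + c - 1) / c)"
    using assms(1) unfolding l_def t by (auto simp: to_E_def Let_def)
  show \<xi>: "E_xi (t, x, y) = 1 / (1 - (b - c) * s)"
    using l0 unfolding E_xi_def prod.case l_def[symmetric] x by simp
  have "y / l^3 = 2 * (- b * E_xi (t, x, y)) - ((1 - 2 * c - c^2) * E_xi (t, x, y) + c - 1) / c"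
    unfolding \<xi> by (subst y) (use l0 in simp)
  then show "E_eta (t, x, y) = - b * E_xi (t, x, y)"
    unfolding E_eta_def prod.case Let_def tc l_def[symmetric] by simp
qed

lemma of_E_to_E:
  assumes c: "c \<noteq> 0" "1 - c \<noteq> 0" and r: "1 - (b - c) * s \<noteq> 0" and bc: "b - c \<noteq> 0"
  shows "of_E (to_E (b, c, s)) = (b, c, s)"
proof -
  obtain t x y where E: "to_E (b, c, s) = (t, x, y)" by (metis prod.exhaust)
  note * = E_coords[OF E c r]
  have "E_xi (t, x, y) \<noteq> 0" using r unfolding *(4) by simp
  then have b: "- E_eta (t, x, y) / E_xi (t, x, y) = b" unfolding *(5) by simp
  have "(E_xi (t, x, y) - 1) / (E_xi (t, x, y) * (b - c)) = s"
    unfolding *(4) using r bc by (simp add: divide_simps)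
  then show ?thesis unfolding E of_E_def prod.case Let_def *(3) b by simp
qed

lemma to_E_of_E:
  assumes "t \<noteq> 0" "t + 1 \<noteq> 0" "E_xi (t, x, y) \<noteq> 0" and bcs: "of_E (t, x, y) = (b, c, s)" and bc: "b - c \<noteq> 0"
  shows "to_E (b, c, s) = (t, x, y)" "c \<noteq> 0" "1 - c \<noteq> 0" "1 - (b - c) * s \<noteq> 0"
proof -
  define \<xi> \<eta> l where "\<xi> = E_xi (t, x, y)" and "\<eta> = E_eta (t, x, y)" and "l = t * (t + 1)"
  have c: "c = t / (t + 1)" and b: "b = - \<eta> / \<xi>" and s: "s = (\<xi> - 1) / (\<xi> * (b - c))"
    using bcs by (auto simp: of_E_def Let_def \<xi>_def \<eta>_def)
  show "c \<noteq> 0" using assms(1,2) by (simp add: c)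
  have c1: "1 - c = 1 / (t + 1)" using assms(2) by (simp add: c divide_simps)
  then show "1 - c \<noteq> 0" using assms(2) by simp
  have l0: "l \<noteq> 0" using assms(1,2) by (simp add: l_def)
  have \<xi>0: "\<xi> \<noteq> 0" using assms(3) by (simp add: \<xi>_def)
  have r: "1 - (b - c) * s = 1 / \<xi>" using \<xi>0 bc by (simp add: s divide_simps)
  then show "1 - (b - c) * s \<noteq> 0" using \<xi>0 by simp
  have t: "c / (1 - c) = t" unfolding c1 using assms(1,2) by (simp add: c)
  have x: "l^2 * (\<xi> - 1) = x" using l0 by (simp add: \<xi>_def E_xi_def l_def)
  have half: "2 * (u / 2) = u" for u :: qbar by simp
  have "2 * \<eta> = y / l^3 + ((1 - 2 * c - c^2) * \<xi> + c - 1) / c"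
    unfolding \<eta>_def \<xi>_def E_eta_def prod.case Let_def c[symmetric] l_def[symmetric] half ..
  then have "l^3 * (2 * \<eta> - ((1 - 2 * c - c^2) * \<xi> + c - 1) / c) = y" using l0 by simp
  moreover have "- b * \<xi> = \<eta>" using \<xi>0 by (simp add: b)
  ultimately show "to_E (b, c, s) = (t, x, y)"
    unfolding to_E_def prod.case Let_def t l_def[symmetric] r using x by simp
qed

section \<open>The parameter space as an open subset of its closure\<close>

lemma subset_zariski_closure: "S \<subseteq> zariski_closure S"
  unfolding zariski_closure_def by auto

text \<open>Polynomial relations pass to the Zariski closure; \<open>h\<close> is
  \<open>cycle_eq\<close> as an element of \<open>poly3\<close>, with coefficients 2 written as
  repeated summands.\<close>

lemma cycle_eq_closure:
  assumes "p \<in> zariski_closure (X_set 5 2)"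
  shows "cycle_eq p = 0"
proof -
  define v1 v2 v3 :: poly3 where "v1 = [:[:[:0, 1:]:]:]" and "v2 = [:[:0, 1:]:]" and "v3 = [:0, 1:]"
  define h :: poly3 where "h = v1 * v1 * v2 * v2 * v3 - (v1 * v1 * v2 * v3 + v1 * v1 * v2 * v3) + v1 * v1 * v3 - v1 * v2 * v2 * v2 * v3
     + v1 * v2 * v2 * v2 - v1 * v2 * v2 + (v1 * v2 * v3 * v3 + v1 * v2 * v3 * v3) - v1 * v3 * v3 - v2 * v2 * v3 * v3 + v2 * v2 * v3"
  have v: "eval3 v1 (x, y, z) = x" "eval3 v2 (x, y, z) = y" "eval3 v3 (x, y, z) = z" for x y z
    by (simp_all add: v1_def v2_def v3_def)
  have "eval3 h (x, y, z) = cycle_eq (x, y, z)" for x y z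
    unfolding h_def eval3_add eval3_diff eval3_mult v cycle_eq.simps by Groebner_Basis.algebra
  then have h: "eval3 h q = cycle_eq q" for q by (cases q) simp
  have "\<forall>q\<in>X_set 5 2. eval3 h q = 0" by (simp add: h X_set_iff del: cycle_eq.simps)
  then have "eval3 h p = 0" using assms unfolding zariski_closure_def by blast
  then show ?thesis by (simp add: h)
qed

lemma X52_eq: "X_set 5 2 = {p \<in> zariski_closure (X_set 5 2). X_nice p}"
  using subset_zariski_closure[of "X_set 5 2"] by (auto simp: X_set_iff cycle_eq_closure simp del: cycle_eq.simps)

text \<open>Applied to the identity on the closure of \<open>X_set 5 2\<close> and to
  \<open>E_to_X\<close> on \<open>E_pre\<close>.\<close>

lemma ratfun_Q_nice_open:
  assumes f: "ratfun_Q U (\<lambda>q. fst (F q))" "ratfun_Q U (\<lambda>q. fst (snd (F q)))"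
     "ratfun_Q U (\<lambda>q. snd (snd (F q)))"
    and U: "principal_open_Q U V"
  shows "principal_open_Q {q \<in> U. X_nice (F q)} V"
proof -
  define x y z where "x q = fst (F q)" and "y q = fst (snd (F q))" and "z q = snd (snd (F q))" for q
  have xyz: "ratfun_Q U x" "ratfun_Q U y" "ratfun_Q U z"
    using f unfolding x_def y_def z_def by auto
  define g where "g q = phi_res (F q) * (x q * y q * z q * (x q - 1) * (y q - 1) * (z q - 1) *
     (x q - y q) * (x q - z q) * (y q - z q)) * (num6 (F q) * (num6 (F q) - den6 (F q)) *
     (num6 (F q) - x q * den6 (F q)) * (num6 (F q) - y q * den6 (F q)) * (num6 (F q) - z q * den6 (F q)))" for q
  have F: "F = (\<lambda>q. (x q, y q, z q))" by (auto simp: x_def y_def z_def)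
  have "{q \<in> U. X_nice (F q)} = {q \<in> U. g q \<noteq> 0}"
    unfolding g_def X_nice_def F prod.case by (auto simp del: phi_res.simps num6.simps den6.simps)
  moreover have "ratfun_Q U g"
    unfolding g_def F phi_res.simps num6.simps den6.simps phi_a1_def phi_a0_def phi_b1_def phi_b0_def
    by (intro ratfun_Q_intros xyz)
  ultimately show ?thesis using principal_open_Q_nonzero[OF U] by simp
qed

lemma X52_to_bcs:
  assumes "(x, y, z) \<in> X_set 5 2" and bcs: "to_bcs (x, y, z) = (b, c, s)"
  shows "c \<noteq> 0" "1 - c \<noteq> 0" "b - c \<noteq> 0" "s \<noteq> 0" "b * s - 1 \<noteq> 0" "1 - (b - c) * s \<noteq> 0"
    "Sig b c s = 0" "of_bcs (b, c, s) = (x, y, z)"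
proof -
  have nz: "y \<noteq> 0" "z \<noteq> 0" "x - 1 \<noteq> 0" "y - 1 \<noteq> 0" "z - 1 \<noteq> 0" "x - y \<noteq> 0" "x - z \<noteq> 0" "y - z \<noteq> 0"
    and C: "cycle_eq (x, y, z) = 0"
    using assms(1) unfolding X_set_iff X_nice_def by blast+
  note * = of_bcs_to_bcs[OF nz(1,2,3,5,6,7,8) bcs]
  show "1 - c \<noteq> 0" "b - c \<noteq> 0" "s \<noteq> 0" "b * s - 1 \<noteq> 0" "of_bcs (b, c, s) = (x, y, z)"
    using * by auto
  have bcs': "b = y * (x - z) / (z * (x - y))" "c = (1 - y) * (x - z) / ((1 - z) * (x - y))" "s = z / y"
    using bcs by (auto simp: to_bcs_def)
  then show c0: "c \<noteq> 0" using nz by simp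
  have z1: "1 - z \<noteq> 0" using nz by simp
  have "Sig b c s * (z * (1 - z)^2 * (x - y)^3 * y^2) = 0"
    using Sig_cycle_eq[OF nz(1,2) z1 nz(6)] C unfolding bcs' by simp
  then show S: "Sig b c s = 0" using nz z1 by auto
  show "1 - (b - c) * s \<noteq> 0" using Sig_at_pole[of b c s] S c0 by auto
qed

section \<open>The bijection between the parameter space and an open subset of E\<close>

definition X_to_E :: "A3 \<Rightarrow> A3" where "X_to_E p = to_E (to_bcs p)"
definition E_to_X :: "A3 \<Rightarrow> A3" where "E_to_X q = of_bcs (of_E q)"

text \<open>The nesting makes each function that is required to be nonzero regular on the preceding set.\<close>

definition E_pre :: "A3 set" where
  "E_pre = {q \<in> {q \<in> {q \<in> {q \<in> {q \<in> {q \<in> E_surface. fst q \<noteq> 0}. fst q + 1 \<noteq> 0}. E_xi q \<noteq> 0}.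
     fst (of_E q) - fst (snd (of_E q)) \<noteq> 0}. snd (snd (of_E q)) \<noteq> 0}.
     fst (of_E q) * snd (snd (of_E q)) - 1 \<noteq> 0}"

definition E_dom :: "A3 set" where
  "E_dom = {q \<in> E_pre. X_nice (E_to_X q)}"

lemma X_to_E:
  assumes "p \<in> X_set 5 2"
  shows "X_to_E p \<in> E_dom" "E_to_X (X_to_E p) = p"
proof -
  obtain x y z where p: "p = (x, y, z)" by (cases p) auto
  obtain b c s where bcs: "to_bcs (x, y, z) = (b, c, s)" by (metis prod.exhaust)
  obtain t u v where E: "to_E (b, c, s) = (t, u, v)" by (metis prod.exhaust)
  note * = X52_to_bcs[OF assms[unfolded p] bcs]
  note ** = E_coords[OF E *(1,2,6)]
  have F: "X_to_E p = (t, u, v)" by (simp add: X_to_E_def p bcs E)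
  have ofE: "of_E (t, u, v) = (b, c, s)" using of_E_to_E[OF *(1,2,6,3)] E by simp
  have "E_to_X (t, u, v) = (x, y, z)" by (simp add: E_to_X_def ofE *(8))
  then show GF: "E_to_X (X_to_E p) = p" using F p by simp
  have "(t, u, v) \<in> E_surface" using to_E_on_surface[OF *(1,2,6,3)] *(7) E by simp
  moreover have "E_xi (t, u, v) \<noteq> 0" using *(6) unfolding **(4) by simp
  ultimately have "(t, u, v) \<in> E_pre" unfolding E_pre_def using * ** by (simp add: ofE)
  moreover have "X_nice p" using assms by (simp add: X_set_iff)
  ultimately show "X_to_E p \<in> E_dom" unfolding E_dom_def using GF unfolding F by simp
qed

lemma E_to_X:
  assumes "q \<in> E_dom"
  shows "E_to_X q \<in> X_set 5 2" "X_to_E (E_to_X q) = q"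
proof -
  obtain t u v where q: "q = (t, u, v)" by (cases q) auto
  obtain b c s where bcs: "of_E (t, u, v) = (b, c, s)" by (metis prod.exhaust)
  obtain x y z where xyz: "of_bcs (b, c, s) = (x, y, z)" by (metis prod.exhaust)
  have *: "(t, u, v) \<in> E_surface" "t \<noteq> 0" "t + 1 \<noteq> 0" "E_xi (t, u, v) \<noteq> 0" "b - c \<noteq> 0" "s \<noteq> 0"
    "b * s - 1 \<noteq> 0" and nice: "X_nice (x, y, z)"
    using assms by (simp_all add: q E_dom_def E_pre_def bcs E_to_X_def xyz)
  note ** = to_E_of_E[OF *(2,3,4) bcs *(5)]
  have nz: "y \<noteq> 0" "z \<noteq> 0" "z - 1 \<noteq> 0" "x - y \<noteq> 0" "x - z \<noteq> 0" "y - z \<noteq> 0"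
    using nice unfolding X_nice_def by auto
  have tob: "to_bcs (x, y, z) = (b, c, s)"
    by (rule to_bcs_of_bcs[OF *(6,5,7) xyz nz(1,3,4)])
  have G: "E_to_X q = (x, y, z)" by (simp add: E_to_X_def q bcs xyz)
  have "X_to_E (x, y, z) = (t, u, v)" by (simp add: X_to_E_def tob **(1))
  then show "X_to_E (E_to_X q) = q" using G q by simp
  have "Sig b c s = 0" using to_E_on_surface[OF **(2,3,4) *(5)] *(1) **(1) by simp
  moreover have "b = y * (x - z) / (z * (x - y))" "c = (1 - y) * (x - z) / ((1 - z) * (x - y))" "s = z / y"
    using tob by (auto simp: to_bcs_def)
  moreover have "1 - z \<noteq> 0" using nz by simp
  ultimately have "(z - x) * (y - z)^2 * cycle_eq (x, y, z) = 0"
    using Sig_cycle_eq[OF nz(1,2) _ nz(4)] by simp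
  then have "cycle_eq (x, y, z) = 0" using nz by auto
  then show "E_to_X q \<in> X_set 5 2" unfolding G X_set_iff using nice by blast
qed

section \<open>Regularity of the two maps over the rationals\<close>

lemma ratfun_Q_X_to_E:
  "ratfun_Q (X_set 5 2) (\<lambda>p. fst (X_to_E p))" "ratfun_Q (X_set 5 2) (\<lambda>p. fst (snd (X_to_E p)))"
  "ratfun_Q (X_set 5 2) (\<lambda>p. snd (snd (X_to_E p)))"
proof -
  define b c s where "b p = fst (to_bcs p)" and "c p = fst (snd (to_bcs p))" and "s p = snd (snd (to_bcs p))" for p
  have nz: "fst p \<noteq> 0 \<and> fst (snd p) \<noteq> 0 \<and> snd (snd p) \<noteq> 0 \<and> fst (snd p) - 1 \<noteq> 0 \<and> 1 - snd (snd p) \<noteq> 0 \<and>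
     fst p - fst (snd p) \<noteq> 0" if "p \<in> X_set 5 2" for p
    using that unfolding X_set_iff X_nice_def by (auto split: prod.splits)
  have b: "ratfun_Q (X_set 5 2) b" and c: "ratfun_Q (X_set 5 2) c" and s: "ratfun_Q (X_set 5 2) s"
    unfolding b_def c_def s_def to_bcs_def case_prod_beta fst_conv snd_conv
    by (intro ratfun_Q_intros; use nz in simp)+
  have nz': "c p \<noteq> 0 \<and> 1 - c p \<noteq> 0 \<and> 1 - (b p - c p) * s p \<noteq> 0" if "p \<in> X_set 5 2" for p
  proof -
    have "(fst p, fst (snd p), snd (snd p)) \<in> X_set 5 2" "to_bcs (fst p, fst (snd p), snd (snd p)) = (b p, c p, s p)"
      using that by (simp_all add: b_def c_def s_def)
    from X52_to_bcs[OF this] show ?thesis by blast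
  qed
  have "X_to_E p = to_E (b p, c p, s p)" for p by (simp add: X_to_E_def b_def c_def s_def)
  then show "ratfun_Q (X_set 5 2) (\<lambda>p. fst (X_to_E p))" "ratfun_Q (X_set 5 2) (\<lambda>p. fst (snd (X_to_E p)))"
    "ratfun_Q (X_set 5 2) (\<lambda>p. snd (snd (X_to_E p)))"
    unfolding to_E_def Let_def prod.case fst_conv snd_conv
    by (simp_all only: prod.case fst_conv snd_conv, (intro ratfun_Q_intros b c s; use nz' in simp)+)
qed

lemma ratfun_Q_of_E:
  assumes "\<And>q. q \<in> S \<Longrightarrow> fst q \<noteq> 0" "\<And>q. q \<in> S \<Longrightarrow> fst q + 1 \<noteq> 0"
  shows "ratfun_Q S E_xi"
    and "(\<And>q. q \<in> S \<Longrightarrow> E_xi q \<noteq> 0) \<Longrightarrow> ratfun_Q S (\<lambda>q. fst (of_E q))"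
    and "ratfun_Q S (\<lambda>q. fst (snd (of_E q)))"
    and "(\<And>q. q \<in> S \<Longrightarrow> E_xi q \<noteq> 0) \<Longrightarrow> (\<And>q. q \<in> S \<Longrightarrow> fst (of_E q) - fst (snd (of_E q)) \<noteq> 0) \<Longrightarrow>
      ratfun_Q S (\<lambda>q. snd (snd (of_E q)))"
proof -
  have "E_xi = (\<lambda>q. 1 + fst (snd q) / (fst q * (fst q + 1))^2)"
    by (auto simp: E_xi_def)
  moreover have "ratfun_Q S (\<lambda>q. 1 + fst (snd q) / (fst q * (fst q + 1))^2)"
    by (intro ratfun_Q_intros) (use assms in simp)
  ultimately show xi: "ratfun_Q S E_xi" by simp
  show c: "ratfun_Q S (\<lambda>q. fst (snd (of_E q)))"
    unfolding of_E_def case_prod_beta Let_def fst_conv snd_conv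
    by (intro ratfun_Q_intros) (use assms in simp)
  have eta: "ratfun_Q S (\<lambda>q. E_eta q)"
    unfolding E_eta_def case_prod_beta Let_def prod.collapse
    by (intro ratfun_Q_intros xi) (use assms in simp_all)
  assume xi0: "\<And>q. q \<in> S \<Longrightarrow> E_xi q \<noteq> 0"
  have b_eq: "fst (of_E q) = - E_eta q / E_xi q" for q
    by (cases q) (simp add: of_E_def Let_def)
  show b: "ratfun_Q S (\<lambda>q. fst (of_E q))"
    unfolding b_eq by (intro ratfun_Q_intros xi eta xi0)
  have s_eq: "snd (snd (of_E q)) = (E_xi q - 1) / (E_xi q * (fst (of_E q) - fst (snd (of_E q))))" for q
    by (cases q) (simp add: of_E_def Let_def)
  assume "\<And>q. q \<in> S \<Longrightarrow> fst (of_E q) - fst (snd (of_E q)) \<noteq> 0"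
  then show "ratfun_Q S (\<lambda>q. snd (snd (of_E q)))"
    unfolding s_eq by (intro ratfun_Q_intros xi b c) (use xi0 in simp)
qed

lemma principal_open_E_pre: "principal_open_Q E_pre E_surface"
  unfolding E_pre_def
  by (intro principal_open_Q_nonzero principal_open_Q_refl ratfun_Q_intros ratfun_Q_of_E) auto

lemma ratfun_Q_E_to_X:
  "ratfun_Q E_pre (\<lambda>q. fst (E_to_X q))" "ratfun_Q E_pre (\<lambda>q. fst (snd (E_to_X q)))"
  "ratfun_Q E_pre (\<lambda>q. snd (snd (E_to_X q)))"
proof -
  have "ratfun_Q E_pre (\<lambda>q. fst (of_E q))" "ratfun_Q E_pre (\<lambda>q. fst (snd (of_E q)))"
    "ratfun_Q E_pre (\<lambda>q. snd (snd (of_E q)))"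
    by (rule ratfun_Q_of_E; simp add: E_pre_def)+
  then show "ratfun_Q E_pre (\<lambda>q. fst (E_to_X q))" "ratfun_Q E_pre (\<lambda>q. fst (snd (E_to_X q)))"
    "ratfun_Q E_pre (\<lambda>q. snd (snd (E_to_X q)))"
    unfolding E_to_X_def of_bcs_def case_prod_beta fst_conv snd_conv
    by (intro ratfun_Q_intros; simp add: E_pre_def)+
qed

lemma ratfun_Q_mono: "ratfun_Q S f \<Longrightarrow> T \<subseteq> S \<Longrightarrow> ratfun_Q T f"
  unfolding ratfun_Q_def by blast

text \<open>Density in E requires a nonempty open subset; the image of this point lies in
  \<open>E_dom\<close>.\<close>

lemma X52_point: "(- 3 / 2, - 1, - 2) \<in> X_set 5 2"
  by (simp add: X_set_iff X_nice_def phi_a1_def phi_a0_def phi_b1_def phi_b0_def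
      power2_eq_square power3_eq_cube field_simps)

lemma birational_X52_E: "birational_over_Q (zariski_closure (X_set 5 2)) E_surface"
proof -
  have open_E: "principal_open_Q E_dom E_surface"
    unfolding E_dom_def by (intro ratfun_Q_nice_open ratfun_Q_E_to_X principal_open_E_pre)
  have dense_E: "dense_in E_dom E_surface"
    by (rule E_surface_dense[OF open_E X_to_E(1)[OF X52_point]])
  have "principal_open_Q {p \<in> zariski_closure (X_set 5 2). X_nice ((\<lambda>p. p) p)} (zariski_closure (X_set 5 2))"
    by (intro ratfun_Q_nice_open principal_open_Q_refl ratfun_Q_vars)
  then have open_X: "principal_open_Q (X_set 5 2) (zariski_closure (X_set 5 2))" using X52_eq by simp
  have dense_X: "dense_in (X_set 5 2) (zariski_closure (X_set 5 2))"
    by (simp add: dense_in_def subset_zariski_closure)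
  have sub: "E_dom \<subseteq> E_surface" "E_dom \<subseteq> E_pre" by (auto simp: E_dom_def E_pre_def)
  have F: "rational_map_over_Q (zariski_closure (X_set 5 2)) E_surface (X_set 5 2) X_to_E"
    unfolding rational_map_over_Q_def
    using open_X dense_X X_to_E(1) sub(1) ratfun_Q_X_to_E
    by (intro conjI principal_open_Q_open ratfun_Q_regular) auto
  have G: "rational_map_over_Q E_surface (zariski_closure (X_set 5 2)) E_dom E_to_X"
    unfolding rational_map_over_Q_def
    using open_E dense_E E_to_X(1) subset_zariski_closure[of "X_set 5 2"] ratfun_Q_E_to_X[THEN ratfun_Q_mono[OF _ sub(2)]]
    by (intro conjI principal_open_Q_open ratfun_Q_regular) auto
  have "{p \<in> X_set 5 2. X_to_E p \<in> E_dom} = (X_set 5 2)" "{q \<in> E_dom. E_to_X q \<in> X_set 5 2} = E_dom"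
    using X_to_E E_to_X by auto
  then show ?thesis
    unfolding birational_over_Q_def using F G dense_X dense_E X_to_E(2) E_to_X(2)
    by (intro exI[of _ "X_set 5 2"] exI[of _ X_to_E] exI[of _ E_dom] exI[of _ E_to_X]) simp
qed

section \<open>Addition of points\<close>

text \<open>The second hypothesis is the divided difference at x1, x2 of the cubic minus
  \<open>(l * x + m)^2\<close>. In this form it covers chord and tangent alike: x1 and x2 are roots
  with multiplicity, and x3 is the third root by Vieta.\<close>

lemma third_intersection:
  fixes x1 x2 x3 l m A B C :: "'a::field_char_0"
  assumes 1: "(l * x1 + m)^2 = 4 * x1^3 + A * x1^2 + B * x1 + C"
    and 2: "4 * (x1^2 + x1 * x2 + x2^2) + (A - l^2) * (x1 + x2) + B - 2 * l * m = 0"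
    and 3: "x3 = (l^2 - A) / 4 - x1 - x2"
  shows "(l * x3 + m)^2 = 4 * x3^3 + A * x3^2 + B * x3 + C"
proof -
  have A: "A = l^2 - 4 * (x1 + x2 + x3)" using 3 by (simp add: field_simps)
  have B: "B = 2 * l * m - 4 * (x1^2 + x1 * x2 + x2^2) - (A - l^2) * (x1 + x2)"
    using 2 by (simp add: algebra_simps)
  have C: "C = (l * x1 + m)^2 - (4 * x1^3 + A * x1^2 + B * x1)"
    using 1 by (simp add: algebra_simps)
  show ?thesis unfolding C B A by (simp add: algebra_simps power2_eq_square power3_eq_cube)
qed

lemma ec_add_closed:
  fixes A B C :: "'a::field_char_0"
  assumes "p \<in> ec_points A B C" "q \<in> ec_points A B C"
  shows "ec_add A B C p q \<in> ec_points A B C"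
proof (cases p; cases q)
  fix x1 y1 x2 y2
  assume pq: "p = Affine x1 y1" "q = Affine x2 y2"
  then have 1: "y1^2 = 4 * x1^3 + A * x1^2 + B * x1 + C" "y2^2 = 4 * x2^3 + A * x2^2 + B * x2 + C"
    using assms by (auto simp: ec_points_def)
  show ?thesis
  proof (cases "x1 = x2 \<and> y1 = - y2")
    case True
    then show ?thesis using pq by (auto simp: ec_points_def)
  next
    case False
    define l where "l = (if x1 = x2 then (12 * x1^2 + 2 * A * x1 + B) / (2 * y1) else (y2 - y1) / (x2 - x1))"
    define m where "m = y1 - l * x1"
    define x3 where "x3 = (l^2 - A) / 4 - x1 - x2"
    have m: "l * x1 + m = y1" by (simp add: m_def)
    have "4 * (x1^2 + x1 * x2 + x2^2) + (A - l^2) * (x1 + x2) + B - 2 * l * m = 0"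
    proof (cases "x1 = x2")
      case True
      then have "y1^2 = y2^2" using 1 by simp
      with True False have y: "y1 \<noteq> 0" by (auto simp: power2_eq_iff)
      have "l * (2 * y1) = 12 * x1^2 + 2 * A * x1 + B" using True y by (simp add: l_def)
      moreover have "4 * (x1^2 + x1 * x2 + x2^2) + (A - l^2) * (x1 + x2) + B - 2 * l * m
          = 12 * x1^2 + 2 * A * x1 + B - l * (2 * (l * x1 + m))"
        using True by (simp add: algebra_simps power2_eq_square)
      ultimately show ?thesis unfolding m by simp
    next
      case F: False
      then have "l * (x2 - x1) = y2 - y1" by (simp add: l_def)
      moreover have "l * x2 + m = l * (x2 - x1) + (l * x1 + m)" by (simp add: algebra_simps)
      ultimately have m2: "l * x2 + m = y2" unfolding m by simp
      have "(x2 - x1) * (4 * (x1^2 + x1 * x2 + x2^2) + (A - l^2) * (x1 + x2) + B - 2 * l * m)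
          = (4 * x2^3 + A * x2^2 + B * x2 + C - (l * x2 + m)^2)
            - (4 * x1^3 + A * x1^2 + B * x1 + C - (l * x1 + m)^2)"
        by (simp add: algebra_simps power2_eq_square power3_eq_cube)
      also have "\<dots> = 0" unfolding m m2 1 by simp
      finally have "(x2 - x1) * (4 * (x1^2 + x1 * x2 + x2^2) + (A - l^2) * (x1 + x2) + B - 2 * l * m) = 0" .
      then show ?thesis using F by simp
    qed
    from third_intersection[OF _ this x3_def, of C] 1(1) m
    have "(- (l * x3 + m))^2 = 4 * x3^3 + A * x3^2 + B * x3 + C" by (simp only: power2_minus)
    moreover have "ec_add A B C p q = Affine x3 (- (l * x3 + m))"
      using False unfolding pq ec_add.simps Let_def l_def[symmetric] x3_def[symmetric] m_def
      by (auto simp: algebra_simps)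
    ultimately show ?thesis unfolding ec_points_def by blast
  qed
qed (use assms in auto)

section \<open>Multiples of a point and the rank\<close>

lemma ec_pow_closed:
  fixes A B C :: "'a::field_char_0"
  assumes "p \<in> carrier (EC A B C)"
  shows "p [^]\<^bsub>EC A B C\<^esub> (n::nat) \<in> carrier (EC A B C)"
proof (induction n)
  case 0
  then show ?case by (simp add: EC_def nat_pow_def ec_points_def)
next
  case (Suc n)
  then show ?case using ec_add_closed[of _ A B C p] assms by (simp add: EC_def nat_pow_def)
qed

lemma ec_add_eq_Origin:
  "ec_add A B C (Affine x y) q = Origin \<longleftrightarrow> q = Affine x (- y)"
  by (cases q) (auto simp: Let_def)

text \<open>\<open>ec_add_eq_Origin\<close> determines the inverse directly from the addition
  formula.\<close>

lemma ec_inv_Affine: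
  assumes "Affine x y \<in> carrier (EC A B C)"
  shows "inv\<^bsub>EC A B C\<^esub> (Affine x y) = Affine x (- y)"
  unfolding m_inv_def using assms
  by (intro the_equality) (auto simp: EC_def ec_add_eq_Origin ec_points_def)

lemma ec_int_pow_Origin:
  fixes A B C :: "'a::field_char_0"
  assumes "infinite_order (EC A B C) p"
  shows "p [^]\<^bsub>EC A B C\<^esub> (c::int) \<in> carrier (EC A B C)"
    and "p [^]\<^bsub>EC A B C\<^esub> c = Origin \<longleftrightarrow> c = 0"
proof -
  let ?G = "EC A B C"
  have p: "p \<in> carrier ?G" and n: "\<And>n::nat. n > 0 \<Longrightarrow> p [^]\<^bsub>?G\<^esub> n \<noteq> Origin"
    using assms by (auto simp: infinite_order_def EC_def)
  have pos: "p [^]\<^bsub>?G\<^esub> c = p [^]\<^bsub>?G\<^esub> nat c" if "c \<ge> 0"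
    using that by (simp add: int_pow_def nat_pow_def)
  have neg: "p [^]\<^bsub>?G\<^esub> c = inv\<^bsub>?G\<^esub> (p [^]\<^bsub>?G\<^esub> nat (- c))" if "c < 0"
    using that by (simp add: int_pow_def nat_pow_def)
  have "p [^]\<^bsub>?G\<^esub> c \<in> carrier ?G \<and> (p [^]\<^bsub>?G\<^esub> c = Origin \<longleftrightarrow> c = 0)"
  proof (cases "c < 0")
    case True
    then obtain x y where xy: "p [^]\<^bsub>?G\<^esub> nat (- c) = Affine x y"
      using n[of "nat (- c)"] by (cases "p [^]\<^bsub>?G\<^esub> nat (- c)") auto
    then have "Affine x y \<in> carrier ?G" using ec_pow_closed[OF p] by metis
    then show ?thesis unfolding neg[OF True] xy using True
      by (auto simp: ec_inv_Affine) (auto simp: EC_def ec_points_def)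
  next
    case False
    then have c: "p [^]\<^bsub>?G\<^esub> c = p [^]\<^bsub>?G\<^esub> nat c" by (intro pos) simp
    show ?thesis
    proof (cases "nat c = 0")
      case True
      have "p [^]\<^bsub>?G\<^esub> (0::nat) = Origin" by (simp add: EC_def nat_pow_def)
      then show ?thesis using True False ec_pow_closed[OF p, of 0] unfolding c by simp
    next
      case nz: False
      then have "p [^]\<^bsub>?G\<^esub> nat c \<noteq> Origin" using n[of "nat c"] by blast
      then show ?thesis using nz ec_pow_closed[OF p, of "nat c"] unfolding c by simp
    qed
  qed
  then show "p [^]\<^bsub>?G\<^esub> c \<in> carrier ?G" "p [^]\<^bsub>?G\<^esub> c = Origin \<longleftrightarrow> c = 0" by auto
qed

text \<open>The library lemmas on \<^const>\<open>finprod\<close> need a commutative monoid, which would require associativity of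
  the addition of points.\<close>

lemma finprod_singleton_raw:
  assumes "f p \<otimes>\<^bsub>G\<^esub> \<one>\<^bsub>G\<^esub> \<in> carrier G" "\<one>\<^bsub>G\<^esub> \<in> carrier G"
  shows "finprod G f {p} = f p \<otimes>\<^bsub>G\<^esub> \<one>\<^bsub>G\<^esub>"
proof -
  let ?R = "foldSetD (carrier G) ((\<otimes>\<^bsub>G\<^esub>) \<circ> f) \<one>\<^bsub>G\<^esub>"
  have "({p}, f p \<otimes>\<^bsub>G\<^esub> \<one>\<^bsub>G\<^esub>) \<in> ?R"
    using foldSetD.insertI[of p "{}" "(\<otimes>\<^bsub>G\<^esub>) \<circ> f" "\<one>\<^bsub>G\<^esub>" "carrier G"] assms
    by (simp add: foldSetD.emptyI)
  moreover have "x = f p \<otimes>\<^bsub>G\<^esub> \<one>\<^bsub>G\<^esub>" if "({p}, x) \<in> ?R" for x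
    using that
  proof cases
    case emptyI
    then show ?thesis by simp
  next
    case (insertI q A y)
    then have "q = p" "A = {}" by auto
    from insertI(5) have "y = \<one>\<^bsub>G\<^esub>" unfolding \<open>A = {}\<close> by cases simp_all
    then show ?thesis using insertI \<open>q = p\<close> by simp
  qed
  ultimately have "(THE x. ({p}, x) \<in> ?R) = f p \<otimes>\<^bsub>G\<^esub> \<one>\<^bsub>G\<^esub>"
    by (rule the_equality)
  then show ?thesis by (simp add: finprod_def foldD_def)
qed

lemma ec_rank_pos:
  fixes A B C :: "'a::field_char_0"
  assumes "infinite_order (EC A B C) p"
  shows "ab_rank (EC A B C) > 0"
proof -
  let ?G = "EC A B C"
  have p: "p \<in> carrier ?G" using assms by (simp add: infinite_order_def)
  have right_Origin: "ec_add A B C q Origin = q" for q by (cases q) auto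
  have "int_independent ?G {p}"
    unfolding int_independent_def
  proof (intro conjI allI impI)
    fix c :: "'a ec_point \<Rightarrow> int"
    assume "(\<Otimes>\<^bsub>?G\<^esub>g\<in>{p}. g [^]\<^bsub>?G\<^esub> c g) = \<one>\<^bsub>?G\<^esub>"
    moreover have "(\<Otimes>\<^bsub>?G\<^esub>g\<in>{p}. g [^]\<^bsub>?G\<^esub> c g) = p [^]\<^bsub>?G\<^esub> c p"
      using ec_int_pow_Origin(1)[OF assms, of "c p"]
      by (subst finprod_singleton_raw) (auto simp: EC_def right_Origin ec_points_def)
    ultimately have "p [^]\<^bsub>?G\<^esub> c p = Origin" by (simp add: EC_def)
    then show "\<forall>g\<in>{p}. c g = 0" using ec_int_pow_Origin(2)[OF assms] by simp
  qed (use p in auto)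
  then have "enat (card {p}) \<le> ab_rank ?G" unfolding ab_rank_def by (intro SUP_upper) simp
  then show ?thesis by (rule less_le_trans[rotated]) (simp add: zero_enat_def)
qed

section \<open>Specialization at a node\<close>

interpretation of_rat_poly_hom: map_poly_comm_ring_hom "of_rat :: rat \<Rightarrow> complex" ..

text \<open>The rational function \<open>r\<close> is regular at \<open>t\<^sub>0\<close>, with value \<open>v\<close>.\<close>

definition evaluates_to :: "complex \<Rightarrow> Qt \<Rightarrow> complex \<Rightarrow> bool" where
  "evaluates_to t0 r v \<longleftrightarrow> (\<exists>a b. poly (map_poly of_rat b) t0 \<noteq> 0 \<and> r = Fract a b \<and>
     v = poly (map_poly of_rat a) t0 / poly (map_poly of_rat b) t0)"

lemma evaluates_to_Fract:
  "poly (map_poly of_rat b) t0 \<noteq> 0 \<Longrightarrow>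
     evaluates_to t0 (Fract a b) (poly (map_poly of_rat a) t0 / poly (map_poly of_rat b) t0)"
  unfolding evaluates_to_def by blast

lemma evaluates_toE:
  assumes "evaluates_to t0 r v"
  obtains a b where "poly (map_poly of_rat b) t0 \<noteq> 0" "b \<noteq> 0" "r = Fract a b"
    "v = poly (map_poly of_rat a) t0 / poly (map_poly of_rat b) t0"
proof -
  obtain a b where *: "poly (map_poly of_rat b) t0 \<noteq> 0" "r = Fract a b"
    "v = poly (map_poly of_rat a) t0 / poly (map_poly of_rat b) t0"
    using assms unfolding evaluates_to_def by blast
  moreover have "b \<noteq> 0" using *(1) by auto
  ultimately show thesis using that by blast
qed

lemma evaluates_to_unique:
  assumes "evaluates_to t0 r v" "evaluates_to t0 r v'"
  shows "v = v'"
proof -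
  obtain a b where 1: "poly (map_poly of_rat b) t0 \<noteq> 0" "b \<noteq> 0" "r = Fract a b"
    "v = poly (map_poly of_rat a) t0 / poly (map_poly of_rat b) t0"
    using assms(1) by (rule evaluates_toE)
  obtain a' b' where 2: "poly (map_poly of_rat b') t0 \<noteq> 0" "b' \<noteq> 0" "r = Fract a' b'"
    "v' = poly (map_poly of_rat a') t0 / poly (map_poly of_rat b') t0"
    using assms(2) by (rule evaluates_toE)
  have "a * b' = a' * b" using 1 2 by (simp add: eq_fract)
  then have "poly (map_poly of_rat (a * b')) t0 = poly (map_poly of_rat (a' * b)) t0" by simp
  then show ?thesis using 1 2 by (simp add: of_rat_poly_hom.hom_mult frac_eq_eq)
qed

lemma evaluates_to_add:
  assumes "evaluates_to t0 r v" "evaluates_to t0 r' v'"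
  shows "evaluates_to t0 (r + r') (v + v')"
proof -
  obtain a b where 1: "poly (map_poly of_rat b) t0 \<noteq> 0" "b \<noteq> 0" "r = Fract a b"
    "v = poly (map_poly of_rat a) t0 / poly (map_poly of_rat b) t0"
    using assms(1) by (rule evaluates_toE)
  obtain a' b' where 2: "poly (map_poly of_rat b') t0 \<noteq> 0" "b' \<noteq> 0" "r' = Fract a' b'"
    "v' = poly (map_poly of_rat a') t0 / poly (map_poly of_rat b') t0"
    using assms(2) by (rule evaluates_toE)
  show ?thesis
    using evaluates_to_Fract[of "b * b'" t0 "a * b' + a' * b"] 1 2
    by (simp add: of_rat_poly_hom.hom_mult of_rat_poly_hom.hom_add add_frac_eq)
qed

lemma evaluates_to_mult:
  assumes "evaluates_to t0 r v" "evaluates_to t0 r' v'"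
  shows "evaluates_to t0 (r * r') (v * v')"
proof -
  obtain a b where 1: "poly (map_poly of_rat b) t0 \<noteq> 0" "b \<noteq> 0" "r = Fract a b"
    "v = poly (map_poly of_rat a) t0 / poly (map_poly of_rat b) t0"
    using assms(1) by (rule evaluates_toE)
  obtain a' b' where 2: "poly (map_poly of_rat b') t0 \<noteq> 0" "b' \<noteq> 0" "r' = Fract a' b'"
    "v' = poly (map_poly of_rat a') t0 / poly (map_poly of_rat b') t0"
    using assms(2) by (rule evaluates_toE)
  show ?thesis
    using evaluates_to_Fract[of "b * b'" t0 "a * a'"] 1 2
    by (simp add: of_rat_poly_hom.hom_mult)
qed

lemma evaluates_to_inverse:
  assumes "evaluates_to t0 r v" "v \<noteq> 0"
  shows "evaluates_to t0 (inverse r) (inverse v)"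
proof -
  obtain a b where 1: "poly (map_poly of_rat b) t0 \<noteq> 0" "b \<noteq> 0" "r = Fract a b"
    "v = poly (map_poly of_rat a) t0 / poly (map_poly of_rat b) t0"
    using assms(1) by (rule evaluates_toE)
  with assms(2) show ?thesis
    using evaluates_to_Fract[of a t0 b] by simp
qed

lemma evaluates_to_divide:
  assumes "evaluates_to t0 r v" "evaluates_to t0 r' v'" "v' \<noteq> 0"
  shows "evaluates_to t0 (r / r') (v / v')"
  unfolding divide_inverse by (intro evaluates_to_mult evaluates_to_inverse assms)

lemma evaluates_to_rat: "evaluates_to t0 (Fract [:c:] 1) (of_rat c)"
  using evaluates_to_Fract[of 1 t0 "[:c:]"] by (cases "c = 0") (simp_all add: map_poly_pCons)

lemma evaluates_to_1: "evaluates_to t0 1 1"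
  using evaluates_to_rat[of t0 1] by (simp add: one_pCons[symmetric] One_fract_def)

lemma evaluates_to_0: "evaluates_to t0 0 0"
  using evaluates_to_rat[of t0 0] by (simp add: Zero_fract_def)

lemma evaluates_to_uminus:
  assumes "evaluates_to t0 r v"
  shows "evaluates_to t0 (- r) (- v)"
proof -
  have "[:- 1:] = (- 1 :: rat poly)" by (simp add: one_pCons)
  then have "evaluates_to t0 (- 1) (- 1)"
    using evaluates_to_rat[of t0 "-1"] by (simp add: One_fract_def)
  from evaluates_to_mult[OF this assms] show ?thesis by simp
qed

lemma evaluates_to_diff:
  assumes "evaluates_to t0 r v" "evaluates_to t0 r' v'"
  shows "evaluates_to t0 (r - r') (v - v')"
  using evaluates_to_add[OF assms(1) evaluates_to_uminus[OF assms(2)]] by simp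

lemma evaluates_to_power: "evaluates_to t0 r v \<Longrightarrow> evaluates_to t0 (r ^ n) (v ^ n)"
  by (induction n) (auto intro: evaluates_to_1 evaluates_to_mult)

lemma evaluates_to_of_nat: "evaluates_to t0 (of_nat n) (of_nat n)"
  by (induction n) (auto intro: evaluates_to_0 evaluates_to_1 evaluates_to_add)

lemma evaluates_to_numeral: "evaluates_to t0 (numeral w) (numeral w)"
  using evaluates_to_of_nat[of t0 "numeral w"] by simp

lemma evaluates_to_t_gen: "evaluates_to t0 t_gen t0"
  using evaluates_to_Fract[of 1 t0 "[:0, 1:]"] by (simp add: t_gen_def)

lemmas evaluates_to_intros = evaluates_to_0 evaluates_to_1 evaluates_to_numeral evaluates_to_t_gen
  evaluates_to_add evaluates_to_diff evaluates_to_uminus evaluates_to_mult evaluates_to_power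
  evaluates_to_divide

text \<open>The point with parameter \<open>U = 1 / (u - 1)\<close> of the nodal cubic
  \<open>y\<^sup>2 = 4 (x - \<alpha>)\<^sup>2 (x - \<beta>)\<close>, where \<open>s\<^sup>2 = 4 (\<alpha> - \<beta>)\<close> and \<open>u\<close> is the
  multiplicative parameter.\<close>

definition node_x :: "'a::field \<Rightarrow> 'a \<Rightarrow> 'a \<Rightarrow> 'a" where
  "node_x \<alpha> s U = \<alpha> + s^2 * (U * (U + 1))"

definition node_y :: "'a::field \<Rightarrow> 'a \<Rightarrow> 'a" where
  "node_y s U = s^3 * (U * (U + 1) * (2 * U + 1))"

text \<open>The relation for W says \<open>1 + 1/W = (1 + 1/U) (1 + 1/V)\<close>, that is, the
  multiplicative parameters multiply. Both claims reduce to multiples of this relation.\<close>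

lemma node_third_point:
  fixes U V W s \<alpha> :: "'a::field_char_0"
  assumes W: "W * (1 + U + V) = U * V" and l: "l = s * (2 * U + 2 * V + 1 - 2 * W)"
  shows "(l^2 - (s^2 - 12 * \<alpha>)) / 4 - node_x \<alpha> s V - node_x \<alpha> s U = node_x \<alpha> s W"
    and "- (node_y s V + l * (node_x \<alpha> s W - node_x \<alpha> s V)) = node_y s W"
proof -
  have 0: "U * V - W * (1 + U + V) = 0" using W by simp
  have "l^2 - (s^2 - 12 * \<alpha>) - 4 * (node_x \<alpha> s V + node_x \<alpha> s U + node_x \<alpha> s W)
      = 8 * s^2 * (U * V - W * (1 + U + V))"
    by (simp add: l node_x_def algebra_simps power2_eq_square)
  then have "l^2 - (s^2 - 12 * \<alpha>) = 4 * (node_x \<alpha> s V + node_x \<alpha> s U + node_x \<alpha> s W)"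
    unfolding 0 by simp
  then have sum: "(l^2 - (s^2 - 12 * \<alpha>)) / 4 = node_x \<alpha> s V + node_x \<alpha> s U + node_x \<alpha> s W"
    by (simp only: nonzero_mult_div_cancel_left[OF zero_neq_numeral[symmetric]])
  show "(l^2 - (s^2 - 12 * \<alpha>)) / 4 - node_x \<alpha> s V - node_x \<alpha> s U = node_x \<alpha> s W"
    unfolding sum by simp
  have "node_y s V + l * (node_x \<alpha> s W - node_x \<alpha> s V) + node_y s W
      = - (2 * s^3 * (V + W + 1)) * (U * V - W * (1 + U + V))"
    by (simp add: l node_x_def node_y_def algebra_simps power2_eq_square power3_eq_cube)
  then have "node_y s V + l * (node_x \<alpha> s W - node_x \<alpha> s V) + node_y s W = 0"
    unfolding 0 by simp
  then show "- (node_y s V + l * (node_x \<alpha> s W - node_x \<alpha> s V)) = node_y s W"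
    by (rule add_eq_0_iff[THEN iffD1, symmetric])
qed

text \<open>Once \<open>U * V\<close> is replaced by \<open>W * (1 + U + V)\<close>, both
  differences have the factor \<open>(U - V) * (1 + U + V)\<close>, which cancels.\<close>

lemma node_chord_slope:
  fixes U V W s \<alpha> :: "'a::field_char_0"
  assumes "W * (1 + U + V) = U * V" "1 + U + V \<noteq> 0" "s \<noteq> 0" "U \<noteq> V"
  shows "node_x \<alpha> s U - node_x \<alpha> s V \<noteq> 0"
    and "(node_y s U - node_y s V) / (node_x \<alpha> s U - node_x \<alpha> s V) = s * (2 * U + 2 * V + 1 - 2 * W)"
proof -
  have x: "node_x \<alpha> s U - node_x \<alpha> s V = s^2 * ((U - V) * (1 + U + V))"
    by (simp add: node_x_def algebra_simps power2_eq_square)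
  show nz: "node_x \<alpha> s U - node_x \<alpha> s V \<noteq> 0" unfolding x using assms by auto
  have "node_y s U - node_y s V = s^3 * ((U - V) * ((2 * U + 2 * V + 1) * (1 + U + V) - 2 * (U * V)))"
    by (simp add: node_y_def algebra_simps power2_eq_square)
  also have "\<dots> = s * (2 * U + 2 * V + 1 - 2 * W) * (s^2 * ((U - V) * (1 + U + V)))"
    unfolding assms(1)[symmetric] by (simp add: algebra_simps power2_eq_square power3_eq_cube)
  finally show "(node_y s U - node_y s V) / (node_x \<alpha> s U - node_x \<alpha> s V)
      = s * (2 * U + 2 * V + 1 - 2 * W)"
    using nz unfolding x by (simp add: divide_eq_eq)
qed

text \<open>The limiting case U = V. Multiplied by \<open>2 * node_y s U\<close>, the slope becomes
  a polynomial in \<open>U * (U + 1)\<close>, which is the derivative of the cubic.\<close>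

lemma node_tangent_slope:
  fixes U W s \<alpha> :: "'a::field_char_0"
  assumes "W * (1 + 2 * U) = U * U" "1 + 2 * U \<noteq> 0" "s \<noteq> 0" "U \<noteq> 0" "U + 1 \<noteq> 0"
  shows "node_y s U \<noteq> 0"
    and "(12 * node_x \<alpha> s U ^ 2 + 2 * (s^2 - 12 * \<alpha>) * node_x \<alpha> s U + (12 * \<alpha>^2 - 2 * \<alpha> * s^2))
      / (2 * node_y s U) = s * (2 * U + 2 * U + 1 - 2 * W)"
proof -
  show nz: "node_y s U \<noteq> 0" using assms by (auto simp: node_y_def add.commute)
  have "(4 * U + 1 - 2 * W) * (1 + 2 * U) = (4 * U + 1) * (1 + 2 * U) - 2 * (W * (1 + 2 * U))"
    by (simp add: algebra_simps)
  also have "\<dots> = 6 * (U * (U + 1)) + 1" unfolding assms(1) by (simp add: algebra_simps)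
  finally have *: "(4 * U + 1 - 2 * W) * (1 + 2 * U) = 6 * (U * (U + 1)) + 1" .
  have "s * (2 * U + 2 * U + 1 - 2 * W) * (2 * node_y s U)
     = 2 * s^4 * (U * (U + 1)) * ((4 * U + 1 - 2 * W) * (1 + 2 * U))"
    by (simp add: node_y_def power_numeral_reduce algebra_simps)
  also have "\<dots> = 2 * s^4 * (U * (U + 1)) * (6 * (U * (U + 1)) + 1)" unfolding * ..
  also have "\<dots> = 12 * node_x \<alpha> s U ^ 2 + 2 * (s^2 - 12 * \<alpha>) * node_x \<alpha> s U + (12 * \<alpha>^2 - 2 * \<alpha> * s^2)"
    by (simp add: node_x_def power_numeral_reduce algebra_simps)
  finally show "(12 * node_x \<alpha> s U ^ 2 + 2 * (s^2 - 12 * \<alpha>) * node_x \<alpha> s U + (12 * \<alpha>^2 - 2 * \<alpha> * s^2))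
      / (2 * node_y s U) = s * (2 * U + 2 * U + 1 - 2 * W)"
    using nz by (simp add: divide_eq_eq)
qed

text \<open>Adding P multiplies the parameter by u. The induction carries the values of both
  coordinates along, since they decide which branch of \<open>ec_add\<close> applies and keep every
  denominator nonzero at \<open>t0\<close>.\<close>

lemma not_Origin_of_node:
  fixes A B C x y :: Qt and U \<alpha> s u t0 :: complex
  defines "G \<equiv> EC A B C"
  assumes A: "evaluates_to t0 A (s^2 - 12 * \<alpha>)"
    and B: "evaluates_to t0 B (12 * \<alpha>^2 - 2 * \<alpha> * s^2)"
    and s: "s \<noteq> 0"
    and x: "evaluates_to t0 x (node_x \<alpha> s (1 / (u - 1)))"
    and y: "evaluates_to t0 y (node_y s (1 / (u - 1)))"
    and u: "u \<noteq> 0" "\<And>n::nat. n > 0 \<Longrightarrow> u ^ n \<noteq> 1"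
    and n: "n > 0"
  shows "\<exists>x' y'. Affine x y [^]\<^bsub>G\<^esub> n = Affine x' y' \<and>
    evaluates_to t0 x' (node_x \<alpha> s (1 / (u ^ n - 1))) \<and> evaluates_to t0 y' (node_y s (1 / (u ^ n - 1)))"
  using n
proof (induction n rule: nat_induct_non_zero)
  case 1
  then show ?case using x y by (simp add: G_def EC_def nat_pow_def)
next
  case (Suc n)
  define U where "U = 1 / (u - 1)"
  define V where "V = 1 / (u ^ n - 1)"
  define W where "W = 1 / (u ^ Suc n - 1)"
  have u1: "u - 1 \<noteq> 0" and un: "u ^ n - 1 \<noteq> 0" and uSn: "u ^ Suc n - 1 \<noteq> 0"
    using u(2)[of 1] u(2)[of n] u(2)[of "Suc n"] Suc.hyps by auto
  have UV1: "1 + U + V = (u ^ Suc n - 1) * (U * V)"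
    unfolding U_def V_def using u1 un by (simp add: divide_simps) (simp add: algebra_simps)
  then have W: "W * (1 + U + V) = U * V" unfolding W_def using uSn by simp
  have U0: "U \<noteq> 0" "V \<noteq> 0" using u1 un by (auto simp: U_def V_def)
  then have UV: "1 + U + V \<noteq> 0" using uSn unfolding UV1 by simp
  have U1: "U + 1 \<noteq> 0" unfolding U_def using u1 u(1) by (simp add: divide_simps)
  obtain x' y' where P: "Affine x y [^]\<^bsub>G\<^esub> n = Affine x' y'"
    and x': "evaluates_to t0 x' (node_x \<alpha> s V)" and y': "evaluates_to t0 y' (node_y s V)"
    using Suc.IH unfolding V_def by blast
  note x = x[folded U_def] and y = y[folded U_def]
  define l where "l = (if x' = x then (12 * x'^2 + 2 * A * x' + B) / (2 * y') else (y - y') / (x - x'))"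
  have "\<not> (x' = x \<and> y' = - y) \<and> evaluates_to t0 l (s * (2 * U + 2 * V + 1 - 2 * W))"
  proof (cases "U = V")
    case True
    have W2: "W * (1 + 2 * U) = U * U" "1 + 2 * U \<noteq> 0"
      using W UV True by (simp_all add: algebra_simps)
    \<comment> \<open>U = V means \<open>u ^ n = u\<close>, so for larger n the number u would be a
      root of unity. Hence the tangent occurs only when P is doubled.\<close>
    have "n = 1"
    proof (rule ccontr)
      assume "n \<noteq> 1"
      then obtain k where k: "n = Suc k" "k > 0" using Suc.hyps by (cases n) auto
      have "u ^ n = u" using True u1 un by (simp add: U_def V_def)
      then have "u ^ k = 1" using u(1) by (simp add: k)
      then show False using u(2) k by blast
    qed
    then have xy: "x' = x" "y' = y" using P by (auto simp: G_def EC_def nat_pow_def)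
    note slope = node_tangent_slope(1)[OF W2 s U0(1) U1] node_tangent_slope(2)[OF W2 s U0(1) U1, of \<alpha>]
    have "y \<noteq> - y"
    proof
      assume "y = - y"
      then have "2 * y = 0" by (simp add: eq_neg_iff_add_eq_0)
      then have "y = 0" by simp
      then have "node_y s U = 0" using evaluates_to_unique[OF y] evaluates_to_0 by blast
      then show False using slope(1) by blast
    qed
    moreover have "evaluates_to t0 l (s * (2 * U + 2 * U + 1 - 2 * W))"
      unfolding l_def xy slope(2)[symmetric] if_True simp_thms
      by (intro evaluates_to_intros x y A B) (use slope(1) in simp)
    ultimately show ?thesis using xy True by simp
  next
    case False
    note slope = node_chord_slope[OF W UV s False, of \<alpha>]
    \<comment> \<open>Different values at \<open>t0\<close> force different abscissae over the
      function field.\<close>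
    have "x' \<noteq> x" using evaluates_to_unique[OF x] x' slope(1) by auto
    moreover have "evaluates_to t0 ((y - y') / (x - x')) (s * (2 * U + 2 * V + 1 - 2 * W))"
      unfolding slope(2)[symmetric] using slope(1) by (intro evaluates_to_intros x y x' y')
    ultimately show ?thesis by (simp add: l_def)
  qed
  then have ne: "\<not> (x' = x \<and> y' = - y)" and l: "evaluates_to t0 l (s * (2 * U + 2 * V + 1 - 2 * W))"
    by auto
  define x3 where "x3 = (l^2 - A) / 4 - x' - x"
  define y3 where "y3 = - (y' + l * (x3 - x'))"
  have "Affine x y [^]\<^bsub>G\<^esub> Suc n = ec_add A B C (Affine x' y') (Affine x y)"
    using P by (simp add: G_def EC_def nat_pow_def)
  also have "\<dots> = Affine x3 y3"
    using ne unfolding ec_add.simps Let_def l_def[symmetric] x3_def y3_def by auto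
  finally have "Affine x y [^]\<^bsub>G\<^esub> Suc n = Affine x3 y3" .
  moreover have x3: "evaluates_to t0 x3 (node_x \<alpha> s W)"
    unfolding x3_def node_third_point(1)[OF W refl, symmetric]
    by (intro evaluates_to_intros l A x x') simp
  moreover have "evaluates_to t0 y3 (node_y s W)"
    unfolding y3_def node_third_point(2)[OF W refl, of s \<alpha>, symmetric]
    by (intro evaluates_to_intros l x3 x' y')
  ultimately show ?case unfolding W_def by blast
qed

section \<open>A nodal fibre\<close>

text \<open>If all roots had distance at least d from z, each linear factor at z would have modulus
  at least d.\<close>

lemma complex_root_near:
  fixes p :: "complex poly"
  assumes "p \<noteq> 0" "cmod (poly p z) < cmod (lead_coeff p) * d ^ Polynomial.degree p" "d > 0"
  shows "\<exists>r. poly p r = 0 \<and> cmod (r - z) < d"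
proof (rule ccontr)
  assume far: "\<not> ?thesis"
  obtain A where A: "size A = Polynomial.degree p"
    "p = Polynomial.smult (lead_coeff p) (\<Prod>x\<in>#A. [:- x, 1:])"
    using alg_closed_imp_factorization[OF assms(1)] by blast
  have "poly p x = 0" if "x \<in># A" for x
    by (subst A(2)) (use that in \<open>auto simp: poly_prod_mset image_iff\<close>)
  then have "\<not> cmod (x - z) < d" if "x \<in># A" for x using far that by blast
  then have "d \<le> cmod (z - x)" if "x \<in># A" for x
    using that by (simp add: norm_minus_commute not_less)
  then have "d ^ size A \<le> (\<Prod>x\<in>#A. cmod (z - x))"
    by (induction A) (use assms(3) in \<open>auto intro!: mult_mono\<close>)
  also have "(\<Prod>x\<in>#A. cmod (z - x)) = cmod (\<Prod>x\<in>#A. (z - x))"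
    by (induction A) (auto simp: norm_mult)
  finally have "cmod (lead_coeff p) * d ^ Polynomial.degree p \<le> cmod (lead_coeff p * (\<Prod>x\<in>#A. (z - x)))"
    unfolding A(1) norm_mult by (intro mult_left_mono) auto
  also have "lead_coeff p * (\<Prod>x\<in>#A. (z - x)) = poly p z"
    by (subst (2) A(2)) (simp add: poly_prod_mset)
  finally show False using assms(2) by simp
qed

section \<open>Interval arithmetic for complex numbers\<close>

definition near :: "complex \<Rightarrow> real \<Rightarrow> real \<Rightarrow> real \<Rightarrow> bool" where
  "near x p q e \<longleftrightarrow> \<bar>Re x - p\<bar> \<le> e \<and> \<bar>Im x - q\<bar> \<le> e"

lemma near_add: "near x p q e \<Longrightarrow> near y p' q' e' \<Longrightarrow> near (x + y) (p + p') (q + q') (e + e')"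
  unfolding near_def by auto

lemma near_scale:
  assumes "near x p q e" "0 \<le> c"
  shows "near (of_real c * x) (c * p) (c * q) (c * e)"
proof -
  have "\<bar>c * Re x - c * p\<bar> = c * \<bar>Re x - p\<bar>" "\<bar>c * Im x - c * q\<bar> = c * \<bar>Im x - q\<bar>"
    using assms(2) by (simp_all add: abs_mult flip: right_diff_distrib)
  with assms show ?thesis by (simp add: near_def mult_left_mono)
qed

lemma near_1: "near 1 1 0 0"
  by (simp add: near_def)

text \<open>The new centre may be rounded: the first summand of each bound is the rounding error,
  the others estimate the propagated errors.\<close>

lemma near_mult:
  assumes x: "near x p q e" and y: "near y p' q' e'"
    and P: "\<bar>p * p' - q * q' - P\<bar> + e' * (\<bar>p\<bar> + \<bar>q\<bar>) + e * (\<bar>p'\<bar> + \<bar>q'\<bar>) + 2 * e * e' \<le> E"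
    and Q: "\<bar>p * q' + q * p' - Q\<bar> + e' * (\<bar>p\<bar> + \<bar>q\<bar>) + e * (\<bar>p'\<bar> + \<bar>q'\<bar>) + 2 * e * e' \<le> E"
  shows "near (x * y) P Q E"
proof -
  define a b c d where "a = Re x - p" and "b = Im x - q" and "c = Re y - p'" and "d = Im y - q'"
  have ab: "\<bar>a\<bar> \<le> e" "\<bar>b\<bar> \<le> e" "\<bar>c\<bar> \<le> e'" "\<bar>d\<bar> \<le> e'"
    using x y by (auto simp: near_def a_def b_def c_def d_def)
  have m: "\<bar>u * v\<bar> \<le> \<bar>u\<bar> * f" if "\<bar>v\<bar> \<le> f" for u v f :: real
    using that by (simp add: abs_mult mult_left_mono)
  have m2: "\<bar>u * v\<bar> \<le> e * e'" if "\<bar>u\<bar> \<le> e" "\<bar>v\<bar> \<le> e'" for u v :: real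
    using that by (simp add: abs_mult mult_mono')
  have "Re (x * y) - P = (p * p' - q * q' - P) + p * c - q * d + p' * a - q' * b + a * c - b * d"
    by (simp add: a_def b_def c_def d_def algebra_simps)
  then have "\<bar>Re (x * y) - P\<bar> \<le> \<bar>p * p' - q * q' - P\<bar> + \<bar>p * c\<bar> + \<bar>q * d\<bar> + \<bar>p' * a\<bar> + \<bar>q' * b\<bar> + \<bar>a * c\<bar> + \<bar>b * d\<bar>"
    by linarith
  also have "\<dots> \<le> \<bar>p * p' - q * q' - P\<bar> + \<bar>p\<bar> * e' + \<bar>q\<bar> * e' + \<bar>p'\<bar> * e + \<bar>q'\<bar> * e + e * e' + e * e'"
    by (intro add_mono m m2 ab order_refl)
  also have "\<dots> \<le> E" using P by (simp add: algebra_simps)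
  finally have 1: "\<bar>Re (x * y) - P\<bar> \<le> E" .
  have "Im (x * y) - Q = (p * q' + q * p' - Q) + p * d + q * c + p' * b + q' * a + a * d + b * c"
    by (simp add: a_def b_def c_def d_def algebra_simps)
  then have "\<bar>Im (x * y) - Q\<bar> \<le> \<bar>p * q' + q * p' - Q\<bar> + \<bar>p * d\<bar> + \<bar>q * c\<bar> + \<bar>p' * b\<bar> + \<bar>q' * a\<bar> + \<bar>a * d\<bar> + \<bar>b * c\<bar>"
    by linarith
  also have "\<dots> \<le> \<bar>p * q' + q * p' - Q\<bar> + \<bar>p\<bar> * e' + \<bar>q\<bar> * e' + \<bar>p'\<bar> * e + \<bar>q'\<bar> * e + e * e' + e * e'"
    by (intro add_mono m m2[of b c] m2[of a d] ab order_refl)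
  also have "\<dots> \<le> E" using Q by (simp add: algebra_simps)
  finally show ?thesis using 1 by (simp add: near_def)
qed

lemma near_const: "near (of_real c) c 0 0"
  by (simp add: near_def)

lemma near_cnj: "near x p q e \<Longrightarrow> near (cnj x) p (- q) e"
  by (auto simp: near_def abs_le_iff)

text \<open>The quintic is the factor of the discriminant of \<open>E\<close> whose roots give nodal fibres. By the
  imaginary part condition, the multiplicative parameter of \<open>P\<close> in the fibre over \<open>t\<^sub>0\<close> does not lie on the unit circle. The
  decimals come from a numerical approximation of one root; the exponent 32 makes the
  value of the quintic smaller than 8 times the fifth power of the required precision.\<close>

lemma quintic_root_off_circle:
  obtains t0 :: complex where
    "8 * t0^5 + 29 * t0^4 + 31 * t0^3 + 5 * t0^2 - 3 * t0 + 1 = 0"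
    "Im ((36 * E_C t0 - E_A t0 * E_B t0)
       * cnj (E_A t0 ^ 3 - 18 * E_A t0 * E_B t0 + 216 * E_C t0)) \<noteq> 0"
proof -
  define f :: "complex poly" where "f = [:1, -3, 5, 31, 29, 8:]"
  define z where "z = Complex (-157867274784928149653132435132191 / 10^32) (32979064701582096416577618559885 / 10^32)"
  have deg: "Polynomial.degree f = 5" "lead_coeff f = 8" "f \<noteq> 0" by (simp_all add: f_def)
  \<comment> \<open>Horner evaluation of the quintic at \<open>z\<close>, with centres rounded to
    multiples of \<open>1 / 10^34\<close>.\<close>
  define h0 :: complex where "h0 = 8"
  define h1 where "h1 = h0 * z + 29"
  define h2 where "h2 = h1 * z + 31"
  define h3 where "h3 = h2 * z + 5"
  define h4 where "h4 = h3 * z + (-3)"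
  define h5 where "h5 = h4 * z + 1"
  have z': "near z (-15786727478492814965313243513219100/10^34) (3297906470158209641657761855988500/10^34) 0" by (simp add: near_def z_def)
  have h0': "near h0 8 0 0" by (simp add: near_def h0_def)
  have g0': "near (h0 * z) (-126293819827942519722505948105752800/10^34) (26383251761265677133262094847908000/10^34) (0)"
    by (rule near_mult[OF h0' z']) simp_all
  have h1': "near h1 (163706180172057480277494051894247200/10^34) (26383251761265677133262094847908000/10^34) (0)"
    using near_add[OF g0' near_const[of 29]] by (simp add: h1_def)
  have g1': "near (h1 * z) (-267139434960860650400884698608923264/10^34) (12338246524274715096170354620609663/10^34) (1/10^34)"
    by (rule near_mult[OF h1' z']) simp_all
  have h2': "near h2 (42860565039139349599115301391076736/10^34) (12338246524274715096170354620609663/10^34) (1/10^34)"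
    using near_add[OF g1' near_const[of 31]] by (simp add: h2_def)
  have g2': "near (h2 * z) (-71731844288992226819482880225468524/10^34) (-5343040068397169245161494992537255/10^34) (3/10^34)"
    by (rule near_mult[OF h2' z']) simp_all
  have h3': "near h3 (-21731844288992226819482880225468524/10^34) (-5343040068397169245161494992537255/10^34) (3/10^34)"
    using near_add[OF g2' near_const[of 5]] by (simp add: h3_def)
  have g3': "near (h3 * z) (36069554980724232558689873447958096/10^34) (1267952757731551934077806131590650/10^34) (7/10^34)"
    by (rule near_mult[OF h3' z']) simp_all
  have h4': "near h4 (6069554980724232558689873447958096/10^34) (1267952757731551934077806131590650/10^34) (7/10^34)"
    using near_add[OF g3' near_const[of "-3"]] by (simp add: h4_def)
  have g4': "near (h4 * z) (-9999999999999999999999999999999686/10^34) (355/10^34) (14/10^34)"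
    by (rule near_mult[OF h4' z']) simp_all
  have h5': "near h5 (314/10^34) (355/10^34) (14/10^34)"
    using near_add[OF g4' near_const[of 1]] by (simp add: h5_def)
  have fz: "poly f z = h5"
    by (simp add: f_def h0_def h1_def h2_def h3_def h4_def h5_def algebra_simps)
  have "\<bar>Re (poly f z)\<bar> \<le> 1 / 10^31" "\<bar>Im (poly f z)\<bar> \<le> 1 / 10^31"
    using h5' unfolding fz near_def abs_le_iff by simp_all
  then have "cmod (poly f z) \<le> 2 / 10^31"
    using cmod_le[of "poly f z"] by linarith
  also have "2 / 10^31 < cmod (lead_coeff f) * (9 / 10^7) ^ Polynomial.degree f"
    unfolding deg(2) unfolding deg(1) by (simp add: power_divide)
  finally obtain t0 where t0: "poly f t0 = 0" "cmod (t0 - z) < 9 / 10^7"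
    using complex_root_near[OF deg(3), of z "9 / 10^7"] by auto
  have "\<bar>Re (t0 - z)\<bar> < 9 / 10^7" "\<bar>Im (t0 - z)\<bar> < 9 / 10^7"
    using abs_Re_le_cmod[of "t0 - z"] abs_Im_le_cmod[of "t0 - z"] t0(2) by linarith+
  \<comment> \<open>The gap between \<open>9 / 10^7\<close> and \<open>1 / 10^6\<close> absorbs the
    rounding of \<open>z\<close> to eight decimals.\<close>
  then have t': "near t0 (-157867275/100000000) (6595813/20000000) (1/1000000)"
    unfolding near_def z_def by (simp add: abs_if split: if_splits)
  note one' = near_1
  \<comment> \<open>With these quantities the coefficients of the fibre are \<open>a\<close>,
    \<open>- 2 * p * m\<close> and \<open>p^2\<close>, and the two factors in the claim become
    \<open>2 * N\<close> and \<open>cnj D\<close>.\<close>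
  define t1 where "t1 = t0 + 1"
  define T where "T = t0 * t1"
  define t2 where "t2 = t0 * t0"
  define q where "q = t2 * T"
  define p where "p = q * t1"
  define a where "a = 1 + 4 * q"
  define m where "m = 1 + 2 * T"
  define am where "am = a * m"
  define am18 where "am18 = am + 18 * p"
  define N where "N = p * am18"
  define a2 where "a2 = a * a"
  define a3 where "a3 = a2 * a"
  define am6 where "am6 = am + 6 * p"
  define pp where "pp = p * am6"
  define D where "D = a3 + 36 * pp"
  have t1': "near t1 (-2314691/4000000) (6595813/20000000) (1/1000000)"
    using near_add[OF t' one'] by (simp add: t1_def)
  have T': "near T (80477303/100000000) (-71147237/100000000) (29/10000000)"
    unfolding T_def by (rule near_mult[OF t' t1']) simp_all
  have t2': "near t2 (119172289/50000000) (-52063151/50000000) (39/10000000)"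
    unfolding t2_def by (rule near_mult[OF t' t']) simp_all
  have q': "near q (117730301/100000000) (-253373621/100000000) (159/10000000)"
    unfolding q_def by (rule near_mult[OF t2' T']) simp_all
  have p': "near p (7716467/50000000) (185446763/100000000) (91/5000000)"
    unfolding p_def by (rule near_mult[OF q' t1']) simp_all
  have a': "near a (142730301/25000000) (-253373621/25000000) (159/2500000)"
    using near_add[OF one' near_scale[OF q', of 4]] by (simp add: a_def)
  have m': "near m (130477303/50000000) (-71147237/50000000) (29/5000000)"
    using near_add[OF one' near_scale[OF T', of 2]] by (simp add: m_def)
  have am': "near am (47698533/100000000) (-1728574931/50000000) (871/2500000)"
    unfolding am_def by (rule near_mult[OF a' m']) simp_all
  have am18': "near am18 (65098269/20000000) (-3722129/3125000) (169/250000)"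
    using near_add[OF am' near_scale[OF p', of 18]] by (simp add: am18_def)
  have N': "near N (33889379/12500000) (146307821/25000000) (14389/10000000)"
    unfolding N_def by (rule near_mult[OF p' am18']) simp_all
  have a2': "near a2 (-7012200479/100000000) (-11572509821/100000000) (10077/5000000)"
    unfolding a2_def by (rule near_mult[OF a' a']) simp_all
  have a3': "near a3 (-78660444049/50000000) (4998352659/100000000) (17501/400000)"
    unfolding a3_def by (rule near_mult[OF a2' a']) simp_all
  have am6': "near am6 (140296137/100000000) (-586117321/25000000) (143/312500)"
    using near_add[OF am' near_scale[OF p', of 6]] by (simp add: am6_def)
  have pp': "near pp (4369394207/100000000) (-101645753/100000000) (2743/2000000)"
    unfolding pp_def by (rule near_mult[OF p' am6']) simp_all
  have D': "near D (-11348323/50000000) (1339105551/100000000) (186253/2000000)"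
    using near_add[OF a3' near_scale[OF pp', of 36]] by (simp add: D_def)
  have cD: "near (cnj D) (-11348323/50000000) (-1339105551/100000000) (186253/2000000)"
    using near_cnj[OF D'] by simp
  have "near (N * cnj D) (78) (-38) 2"
    by (rule near_mult[OF N' cD]) simp_all
  then have Im: "Im (N * cnj D) \<noteq> 0" by (auto simp: near_def)
  have E: "E_A t0 = a" "E_B t0 = - 2 * p * m" "E_C t0 = p^2"
    by (simp_all add: E_A_def E_B_def E_C_def a_def m_def p_def q_def t2_def T_def t1_def
        power_numeral_reduce algebra_simps)
  have N2: "36 * E_C t0 - E_A t0 * E_B t0 = 2 * N"
    unfolding E by (simp add: N_def am18_def am_def algebra_simps power2_eq_square)
  have D2: "E_A t0 ^ 3 - 18 * E_A t0 * E_B t0 + 216 * E_C t0 = D"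
    unfolding E by (simp add: D_def pp_def am6_def am_def a3_def a2_def algebra_simps
        power2_eq_square power3_eq_cube)
  have f0: "8 * t0^5 + 29 * t0^4 + 31 * t0^3 + 5 * t0^2 - 3 * t0 + 1 = 0"
    using t0(1) by (simp add: f_def power_numeral_reduce algebra_simps)
  have "Im (2 * N * cnj D) \<noteq> 0" using Im by (simp only: mult.assoc) simp
  then show thesis by (intro that[OF f0]) (unfold N2 D2)
qed

text \<open>The factorization makes the fibre over a root of the quintic singular and, evaluated at
  t = 1, shows that E is nonsingular over the function field.\<close>

lemma cubic_disc_E:
  "cubic_disc (E_A t) (E_B t) (E_C t)
     = 16 * t^7 * (t + 1)^9 * (8 * t^5 + 29 * t^4 + 31 * t^3 + 5 * t^2 - 3 * t + 1)"
  for t :: "'a::idom"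
proof -
  define p where "p = t^3 * (t + 1)^2"
  define m where "m = 2 * t^2 + 2 * t + 1"
  have E: "E_B t = - 2 * p * m" "E_C t = p^2"
    by (simp_all add: E_B_def E_C_def p_def m_def power_mult_distrib flip: power_mult)
  have "cubic_disc (E_A t) (E_B t) (E_C t)
      = p^2 * (4 * E_A t ^ 2 * m^2 + 128 * p * m^3 - 4 * E_A t ^ 3 - 432 * p^2 - 144 * p * E_A t * m)"
    unfolding cubic_disc_def E by (simp add: algebra_simps power_numeral_reduce)
  also have "4 * E_A t ^ 2 * m^2 + 128 * p * m^3 - 4 * E_A t ^ 3 - 432 * p^2 - 144 * p * E_A t * m
      = 16 * t * (t + 1)^5 * (8 * t^5 + 29 * t^4 + 31 * t^3 + 5 * t^2 - 3 * t + 1)"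
    unfolding E_A_def p_def m_def by (simp add: algebra_simps power_numeral_reduce)
  also have "p^2 * \<dots> = 16 * t^7 * (t + 1)^9 * (8 * t^5 + 29 * t^4 + 31 * t^3 + 5 * t^2 - 3 * t + 1)"
    unfolding p_def by (simp add: power_numeral_reduce)
  finally show ?thesis .
qed

lemma P_in_E: "Affine 0 (t_gen^3 * (t_gen + 1)^2) \<in> carrier E_Qt"
  by (simp add: E_Qt_def EC_def ec_points_def E_C_def power_mult_distrib flip: power_mult)

lemma cubic_disc_E_Qt: "cubic_disc (E_A t_gen) (E_B t_gen) (E_C t_gen) \<noteq> 0"
proof
  assume "cubic_disc (E_A t_gen) (E_B t_gen) (E_C t_gen) = 0"
  moreover have "evaluates_to 1 (cubic_disc (E_A t_gen) (E_B t_gen) (E_C t_gen))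
      (16 * 1^7 * (1 + 1)^9 * (8 * 1^5 + 29 * 1^4 + 31 * 1^3 + 5 * 1^2 - 3 * 1 + 1))"
    unfolding cubic_disc_E by (intro evaluates_to_intros)
  ultimately show False using evaluates_to_unique[OF evaluates_to_0] by force
qed

text \<open>For u on the unit circle other than 1, the quotient (u + 1) / (u - 1) is purely
  imaginary, so its square is real.\<close>

lemma nonreal_not_root_of_unity:
  fixes u :: complex
  assumes "Im (((u + 1) / (u - 1))^2) \<noteq> 0" "n > 0"
  shows "u ^ n \<noteq> 1"
proof
  assume "u ^ n = 1"
  then have "cmod u ^ n = 1" by (metis norm_one norm_power)
  then have "cmod u = 1" using assms(2) power_eq_imp_eq_base[of "cmod u" n 1] by simp
  then have u: "u * cnj u = 1" by (simp add: complex_norm_square[symmetric])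
  have "u \<noteq> 1" using assms(1) by auto
  then have "cnj u \<noteq> 1" by (metis complex_cnj_cancel_iff complex_cnj_one)
  have "(cnj u + 1) * (u - 1) = - ((u + 1) * (cnj u - 1))"
    using u by (simp add: algebra_simps)
  then have "cnj ((u + 1) / (u - 1)) = - ((u + 1) / (u - 1))"
    using \<open>u \<noteq> 1\<close> \<open>cnj u \<noteq> 1\<close> by (simp add: divide_simps)
  then have "cnj (((u + 1) / (u - 1))^2) = ((u + 1) / (u - 1))^2"
    by (simp only: complex_cnj_power power2_minus)
  then have "Im (((u + 1) / (u - 1))^2) = - Im (((u + 1) / (u - 1))^2)"
    by (metis cnj.simps(2))
  then show False using assms(1) by simp
qed

lemma E_infinite_order: "infinite_order E_Qt (Affine 0 (t_gen^3 * (t_gen + 1)^2))"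
proof -
  obtain t0 :: complex where f: "8 * t0^5 + 29 * t0^4 + 31 * t0^3 + 5 * t0^2 - 3 * t0 + 1 = 0"
    and Im: "Im ((36 * E_C t0 - E_A t0 * E_B t0)
       * cnj (E_A t0 ^ 3 - 18 * E_A t0 * E_B t0 + 216 * E_C t0)) \<noteq> 0"
    by (rule quintic_root_off_circle)
  define a b c where "a = E_A t0" and "b = E_B t0" and "c = E_C t0"
  define N where "N = 36 * c - a * b"
  define D where "D = a^3 - 18 * a * b + 216 * c"
  define d where "d = a^2 - 12 * b"
  define y0 where "y0 = t0^3 * (t0 + 1)^2"
  have disc: "cubic_disc a b c = 0" unfolding a_def b_def c_def cubic_disc_E f by simp
  have ND: "Im (N * cnj D) \<noteq> 0" using Im by (simp add: N_def D_def a_def b_def c_def)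
  then have "N \<noteq> 0" "D \<noteq> 0" by auto
  \<comment> \<open>A cusp would require d = 0; it is excluded because \<open>D^2 = d^3\<close> when
    the discriminant vanishes.\<close>
  have "D^2 - d^3 = - 108 * cubic_disc a b c"
    by (simp add: D_def d_def cubic_disc_def algebra_simps power_numeral_reduce)
  then have "d \<noteq> 0" using \<open>D \<noteq> 0\<close> disc by auto
  \<comment> \<open>The double root of the degenerate cubic. \<open>s^2\<close> is half the second
    derivative there, \<open>12 * \<alpha> + a\<close>.\<close>
  define \<alpha> where "\<alpha> = N / (2 * d)"
  define s where "s = csqrt (D / d)"
  have s2: "s^2 = D / d" by (simp add: s_def)
  then have "s \<noteq> 0" using \<open>D \<noteq> 0\<close> \<open>d \<noteq> 0\<close> by auto
  have "\<alpha> \<noteq> 0" using \<open>N \<noteq> 0\<close> \<open>d \<noteq> 0\<close> by (simp add: \<alpha>_def)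
  have "D = 6 * N + a * d" by (simp add: D_def N_def d_def algebra_simps power_numeral_reduce)
  then have "a = (D - 6 * N) / d" using \<open>d \<noteq> 0\<close> by simp
  then have a: "a = s^2 - 12 * \<alpha>" by (simp add: s2 \<alpha>_def diff_divide_distrib)
  have "3 * N^2 + a * N * d + b * d^2 = - 9 * cubic_disc a b c"
    by (simp add: N_def d_def cubic_disc_def algebra_simps power_numeral_reduce)
  then have b0: "3 * N^2 + a * N * d + b * d^2 = 0" using disc by simp
  have "12 * \<alpha>^2 + 2 * a * \<alpha> + b = (3 * N^2 + a * N * d + b * d^2) / d^2"
    using \<open>d \<noteq> 0\<close> by (simp add: \<alpha>_def field_simps power2_eq_square)
  then have "12 * \<alpha>^2 + 2 * a * \<alpha> + b = 0" unfolding b0 by simp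
  then have b: "b = 12 * \<alpha>^2 - 2 * \<alpha> * s^2"
    unfolding a by (simp add: algebra_simps power2_eq_square eq_neg_iff_add_eq_0 add_eq_0_iff)
  have "4 * c * d^3 - (4 * N^3 + a * N^2 * d) = (432 * c - a^3) * cubic_disc a b c"
    by (simp add: N_def d_def cubic_disc_def algebra_simps power_numeral_reduce)
  then have c0: "4 * c * d^3 = 4 * N^3 + a * N^2 * d" using disc by simp
  have "8 * \<alpha>^3 + a * \<alpha>^2 = (4 * N^3 + a * N^2 * d) / (4 * d^3)"
    using \<open>d \<noteq> 0\<close> by (simp add: \<alpha>_def field_simps power2_eq_square power3_eq_cube)
  also have "\<dots> = c" unfolding c0[symmetric] using \<open>d \<noteq> 0\<close> by simp
  finally have c: "c = \<alpha>^2 * s^2 - 4 * \<alpha>^3"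
    unfolding a by (simp add: algebra_simps power2_eq_square power3_eq_cube)
  have y0: "y0^2 = c" by (simp add: y0_def c_def E_C_def power_mult_distrib flip: power_mult)
  \<comment> \<open>P has abscissa 0, so its parameter must satisfy
    \<open>U * (U + 1) = - (\<alpha> / s^2)\<close>. This fixes \<open>2 * U + 1\<close> up to sign,
    and the ordinate \<open>y0\<close> selects the value \<open>k\<close>.\<close>
  define k where "k = - (y0 / (s * \<alpha>))"
  have "k^2 = c / (s^2 * \<alpha>^2)" by (simp add: k_def power_divide power_mult_distrib y0)
  also have "\<dots> = 1 - 4 * \<alpha> / s^2"
    using \<open>s \<noteq> 0\<close> \<open>\<alpha> \<noteq> 0\<close>
    unfolding c by (simp add: field_simps power2_eq_square power3_eq_cube)
  finally have k2: "k^2 = 1 - 4 * \<alpha> / s^2" .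
  have "\<alpha> / s^2 = N / (2 * D)" using \<open>d \<noteq> 0\<close> by (simp add: s2 \<alpha>_def)
  moreover have "k^2 = 1 - 4 * (\<alpha> / s^2)" unfolding k2 by simp
  ultimately have k2': "k^2 = 1 - 2 * (N / D)" by simp
  \<comment> \<open>The condition on the imaginary part from \<open>quintic_root_off_circle\<close>
    enters here, as \<open>N / D\<close> is a positive real multiple of
    \<open>N * cnj D\<close>.\<close>
  have "Im (N / D) \<noteq> 0" using ND \<open>D \<noteq> 0\<close> by (simp add: complex_div_cnj[of N D])
  moreover have "Im (k^2) = - (2 * Im (N / D))" unfolding k2' by (simp del: times_divide_eq_right)
  ultimately have Imk: "Im (k^2) \<noteq> 0" by simp
  define u where "u = (k + 1) / (k - 1)"
  have k1: "k - 1 \<noteq> 0" "k + 1 \<noteq> 0" using Imk by (auto simp: add_eq_0_iff2)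
  then have u1: "u - 1 = 2 / (k - 1)" "u + 1 = 2 * k / (k - 1)"
    by (simp_all add: u_def field_simps)
  have "u \<noteq> 0" using k1 by (simp add: u_def)
  have "(u + 1) / (u - 1) = k" unfolding u1 using k1 by simp
  then have roots: "u ^ n \<noteq> 1" if "n > 0" for n
    using nonreal_not_root_of_unity[of u n] Imk that by simp
  define U where "U = 1 / (u - 1)"
  have U: "U = (k - 1) / 2" unfolding U_def u1 using k1 by simp
  have UU: "U * (U + 1) = - (\<alpha> / s^2)"
  proof -
    have "U * (U + 1) = (k^2 - 1) / 4" unfolding U by (simp add: field_simps power2_eq_square)
    then show ?thesis unfolding k2 by simp
  qed
  have x: "node_x \<alpha> s U = 0" unfolding node_x_def UU using \<open>s \<noteq> 0\<close> by simp
  have "node_y s U = - (s * \<alpha> * k)"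
    unfolding node_y_def UU unfolding U using \<open>s \<noteq> 0\<close>
    by (simp add: field_simps power2_eq_square power3_eq_cube)
  also have "\<dots> = y0" using \<open>s \<noteq> 0\<close> \<open>\<alpha> \<noteq> 0\<close> by (simp add: k_def)
  finally have y: "node_y s U = y0" .
  have "evaluates_to t0 (E_A t_gen) a" "evaluates_to t0 (E_B t_gen) b"
    unfolding a_def b_def E_A_def E_B_def by (intro evaluates_to_intros)+
  moreover have "evaluates_to t0 (t_gen^3 * (t_gen + 1)^2) y0"
    unfolding y0_def by (intro evaluates_to_intros)
  ultimately have "Affine 0 (t_gen^3 * (t_gen + 1)^2) [^]\<^bsub>E_Qt\<^esub> n \<noteq> Origin" if "n > 0" for n :: nat
    using not_Origin_of_node[of t0 "E_A t_gen" s \<alpha> "E_B t_gen" 0 u "t_gen^3 * (t_gen + 1)^2" n "E_C t_gen"]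
      roots that \<open>s \<noteq> 0\<close> \<open>u \<noteq> 0\<close> evaluates_to_0
    unfolding a b U_def[symmetric] x y E_Qt_def by (metis ec_point.distinct(1))
  then show ?thesis unfolding infinite_order_def using P_in_E by (simp add: E_Qt_def EC_def)
qed

theorem theorem3p6:
  shows "birational_over_Q (zariski_closure (X_set 5 2)) E_surface \<and>
    cubic_disc (E_A t_gen) (E_B t_gen) (E_C t_gen) \<noteq> 0 \<and>
    Affine 0 (t_gen^3 * (t_gen + 1)^2) \<in> carrier E_Qt \<and>
    infinite_order E_Qt (Affine 0 (t_gen^3 * (t_gen + 1)^2)) \<and>
    ab_rank E_Qt > 0"
  using birational_X52_E cubic_disc_E_Qt P_in_E E_infinite_order
    ec_rank_pos[OF E_infinite_order[unfolded E_Qt_def]]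
  by (simp add: E_Qt_def)

end
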